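(* Let $\delta>0$ and $\varepsilon\in(0,1)$. Let $f=\sum_{\boldsymbol k\in\mathbb N^d}c_{\boldsymbol k}\Phi_{\boldsymbol k}\in L_2(\mathcal D,\mu)$ be a smooth enough function (in the sense of the context) such that the finite index set $I_{3\delta}\subset\mathbb N^d$, determined by $|c_{\boldsymbol k}|\ge 3\delta$ for all $\boldsymbol k\in I_{3\delta}$ and $|c_{\boldsymbol k}|<3\delta$ for all $\boldsymbol k\notin I_{3\delta}$, is non-empty. Assume that there is some $\delta_\Psi<\delta$ such that, uniformly for all cubature rules $Q$ possibly used in the Dimension-incremental Algorithm described in the context, the projection error terms satisfy $$\left\|\Psi_{\mathfrak u,\boldsymbol k}^{Q,I_{3\delta}}\right\|_{L_1(\mathcal D_{\mathfrak u^{c}})}<\delta_\Psi$$ for $\mathfrak u=\{t\}$, $t=1,\dots,d$, and all $\boldsymbol k\in\mathcal P_{\mathfrak u}(I_{3\delta})$, and for $\mathfrak u=\{1,\dots,t\}$, $t=2,\dots,d-1$, and all $\boldsymbol k\in\left(I_{\{1,\dots,t-1\}}\times I_{\{t\}}\right)\cap\mathcal P_{\{1,\dots,t\}}(I_{3\delta})$. Let $C\in\mathbb R$ be such that $C\ge C_Q$ for all possibly used cubature rules $Q$. Apply the Dimension-incremental Algorithm to $f$ with the following parameters: - a search space $\Gamma\subset\mathbb N^d$ with $I_{3\delta}\subset\Gamma$; - a detection threshold $\delta_+>0$ with $3B(\delta_++\delta_\Psi)<\min_{\boldsymbol k\in I_{3\delta}}|c_{\boldsymbol k}|$; - a number of detection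 iterations $$r\ge\left(1+\tfrac32B^2|I_{3\delta}|+\frac{B^3C}{2\delta}\sum_{\boldsymbol h\in\mathbb N^d\setminus I_{3\delta}}|c_{\boldsymbol h}|\right)\left(\log 3+\log d+\log|I_{3\delta}|-\log\varepsilon\right);$$ - sparsity parameters $s\le s_{\mathrm{local}}$ large enough that the cut-off to the largest coefficients never discards an index $\boldsymbol k\in\mathcal P_{\mathfrak u}(I_{3\delta})$ with $|\hat f^{Q}_{\mathfrak u,\boldsymbol k}(\tilde{\boldsymbol x})|\ge\delta_+$ in any detection iteration. Assume that, for each $t=2,\dots,d$, the construction of the cubature rule $Q$ in Step 2 fails with probability at most $\varepsilon/(3d)$. Then, with probability at least $1-\varepsilon$, the output index set $I$ of the algorithm contains the whole set $I_{3\delta}$.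
   Context: **Setting.** $\mathbb N=\{0,1,2,\dots\}$. For $j=1,\dots,d$ let $(\mathcal D_j,\mathcal A_j,\mu_j)$ be probability spaces with $\mathcal D_j\subset\mathbb R$ Borel and $L_2(\mathcal D_j,\mu_j)$ (complex-valued functions) a separable Hilbert space with orthonormal basis $\{\phi_{j,k}:k\in\mathbb N\}$, bounded: $B_j:=\max_{k\in\mathbb N}\operatorname{ess\,sup}_{x\in\mathcal D_j}|\phi_{j,k}(x)|\in[1,\infty)$. Put $\mathcal D=\prod_{j}\mathcal D_j$, $\mu=\prod_j\mu_j$ (product measure), $\Phi_{\boldsymbol k}(\boldsymbol x)=\prod_{j=1}^d\phi_{j,k_j}(x_j)$ for $\boldsymbol k\in\mathbb N^d$, and $B=\prod_{j=1}^dB_j$. "$f\in L_2(\mathcal D,\mu)$ is smooth enough" means that there are coefficients $c_{\boldsymbol k}\in\mathbb C$ with $\sum_{\boldsymbol k\in\mathbb N^d}|c_{\boldsymbol k}|<\infty$ and $f(\boldsymbol x)=\sum_{\boldsymbol k\in\mathbb N^d}c_{\boldsymbol k}\Phi_{\boldsymbol k}(\boldsymbol x)$ pointwise for all $\boldsymbol x\in\mathcal D$. **Notation.** For $\mathfrak u\subset\{1,\dots,d\}$, $\mathfrak u^c=\{1,\dots,d\}\setminus\mathfrak u$; $\mathcal D_{\mathfrak u}=\prod_{j\in\mathfrak u}\mathcal D_j$, $\mu_{\mathfrak u}=\prod_{j\in\mathfrak u}\mu_j$, $\Phi_{\mathfrak u,\boldsymbol k}(\boldsymbol\xi)=\prod_{j\in\mathfrak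 u}\phi_{j,k_j}(\xi_j)$; $\boldsymbol h_{\mathfrak u}=(h_j)_{j\in\mathfrak u}$ for $\boldsymbol h\in\mathbb N^d$; $f(\boldsymbol\xi,\tilde{\boldsymbol x})_{\mathfrak u}$ is $f$ evaluated at the point with components $\xi_j$ for $j\in\mathfrak u$ and $\tilde x_j$ for $j\in\mathfrak u^c$. For $\Omega\subset\mathbb N^d$, $\mathcal P_{\mathfrak u}(\Omega)=\{\boldsymbol h_{\mathfrak u}:\boldsymbol h\in\Omega\}$. $L_p(\mathcal D_{\mathfrak u^c})$ norms are with respect to $\mu_{\mathfrak u^c}$. **Cubature.** A cubature rule $Q$ on $\mathcal D_{\mathfrak u}$ has weights $w_1,\dots,w_M$ and nodes $\boldsymbol\xi_1,\dots,\boldsymbol\xi_M\in\mathcal D_{\mathfrak u}$. It is exact for a finite set $K\subset\mathbb N^{|\mathfrak u|}$ if $\sum_{j=1}^Mw_j\Phi_{\mathfrak u,\boldsymbol k_1}(\boldsymbol\xi_j)\overline{\Phi_{\mathfrak u,\boldsymbol k_2}(\boldsymbol\xi_j)}=\delta_{\boldsymbol k_1,\boldsymbol k_2}$ for all $\boldsymbol k_1,\boldsymbol k_2\in K$. Put $C_Q=\sum_{j=1}^M|w_j|$. The approximated projected coefficients with anchor $\tilde{\boldsymbol x}\in\mathcal D_{\mathfrak u^c}$ are $\hat f_{\mathfrak u,\boldsymbol k}^{Q}(\tilde{\boldsymbol x})=\sum_{j=1}^Mw_jf(\boldsymbol\xi_j,\tilde{\boldsymbol x})_{\mathfrak u}\overline{\Phi_{\mathfrak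 u,\boldsymbol k}(\boldsymbol\xi_j)}$. For $J\subset\mathbb N^d$ the projection error term is $$\Psi_{\mathfrak u,\boldsymbol k}^{Q,J}(\tilde{\boldsymbol x})=\sum_{\boldsymbol h\in\mathbb N^d\setminus J}c_{\boldsymbol h}\Phi_{\mathfrak u^c,\boldsymbol h_{\mathfrak u^c}}(\tilde{\boldsymbol x})\sum_{j=1}^Mw_j\Phi_{\mathfrak u,\boldsymbol h_{\mathfrak u}}(\boldsymbol\xi_j)\overline{\Phi_{\mathfrak u,\boldsymbol k}(\boldsymbol\xi_j)}.$$ **Dimension-incremental Algorithm.** Input: search space $\Gamma\subset\mathbb N^d$, point evaluations of $f$, sparsity parameters $s\le s_{\mathrm{local}}$ in $\mathbb N$, detection threshold $\delta_+>0$, number of detection iterations $r\in\mathbb N$. Step 1: for $t=1,\dots,d$, set $\mathfrak u=\{t\}$, $I_{\mathfrak u}=\emptyset$, and find a cubature rule $Q$ on $\mathcal D_{\mathfrak u}$ exact for $K=\mathcal P_{\mathfrak u}(\Gamma)$. Repeat $r$ times: draw an anchor $\tilde{\boldsymbol x}\in\mathcal D_{\mathfrak u^c}$ at random according to $\mu_{\mathfrak u^c}$ (independently of all other draws), compute $\hat f^Q_{\mathfrak u,k}(\tilde{\boldsymbol x})$ for $k\in K$, and add to $I_{\mathfrak u}$ the indices $k\in K$ belonging to the (up to) $s_{\mathrm{local}}$ largest values $|\hat f^Q_{\mathfrak u,k}(\tilde{\boldsymbol x})|$ that are $\ge\delta_+$. Step 2: for $t=2,\dots,d$, let $(\tilde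 r,\tilde s)=(r,s_{\mathrm{local}})$ if $t<d$ and $(\tilde r,\tilde s)=(1,s)$ if $t=d$. Set $\mathfrak u=\{1,\dots,t\}$, $I_{\mathfrak u}=\emptyset$, $K=(I_{\{1,\dots,t-1\}}\times I_{\{t\}})\cap\mathcal P_{\mathfrak u}(\Gamma)$, and construct (possibly by a randomized procedure that may fail) a cubature rule $Q$ on $\mathcal D_{\mathfrak u}$ exact for $K$. Repeat $\tilde r$ times: draw an anchor $\tilde{\boldsymbol x}\in\mathcal D_{\mathfrak u^c}$ according to $\mu_{\mathfrak u^c}$ (no anchor if $t=d$), compute $\hat f^Q_{\mathfrak u,\boldsymbol k}(\tilde{\boldsymbol x})$ for $\boldsymbol k\in K$, and add to $I_{\mathfrak u}$ the indices $\boldsymbol k\in K$ belonging to the (up to) $\tilde s$ largest values $|\hat f^Q_{\mathfrak u,\boldsymbol k}(\tilde{\boldsymbol x})|$ that are $\ge\delta_+$. Output: $I=I_{\{1,\dots,d\}}$ and the coefficients $\hat f^Q_{\{1,\dots,d\},\boldsymbol k}$, $\boldsymbol k\in I$.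
   Formalization: The projection error bound is also assumed for the last step, u={1,…,d} (d≥2), i.e. t ranges over 2,…,d instead of 2,…,d−1; without it an exact but aliasing final cubature rule can make the output empty, so the claim fails as printed. *)

theory Defs
  imports "HOL-Probability.Probability"
begin

section \<open>Bounded orthonormal product bases\<close>

definition L2 :: "'a measure \<Rightarrow> ('a \<Rightarrow> complex) set" where
  "L2 M = {g \<in> borel_measurable M. integrable M (\<lambda>x. (cmod (g x))\<^sup>2)}"

text \<open>Orthonormal system whose linear span is dense in the space of square-integrable functions.\<close>

definition orthonormal_basis :: "'a measure \<Rightarrow> (nat \<Rightarrow> 'a \<Rightarrow> complex) \<Rightarrow> bool" where
  "orthonormal_basis M e \<longleftrightarrow>
     (\<forall>k. e k \<in> L2 M) \<and>
     (\<forall>k l. (\<integral>x. e k x * cnj (e l x) \<partial>M) = (if k = l then 1 else 0)) \<and>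
     (\<forall>g\<in>L2 M. \<forall>\<eta>>0. \<exists>n a. (\<integral>x. (cmod (g x - (\<Sum>k<n. a k * e k x)))\<^sup>2 \<partial>M) < \<eta>)"

definition ess_bound :: "'a measure \<Rightarrow> (nat \<Rightarrow> 'a \<Rightarrow> complex) \<Rightarrow> ereal" where
  "ess_bound M e = (SUP k. esssup M (\<lambda>x. ereal (cmod (e k x))))"

text \<open>The carrier of the \<open>j\<close>-th probability space is \<open>space (\<mu> j)\<close>; coordinates run over
  \<open>{1..d}\<close>.\<close>

definition bounded_product_setting ::
    "nat \<Rightarrow> (nat \<Rightarrow> real measure) \<Rightarrow> (nat \<Rightarrow> nat \<Rightarrow> real \<Rightarrow> complex) \<Rightarrow> bool" where
  "bounded_product_setting d \<mu> \<phi> \<longleftrightarrow>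
     1 \<le> d \<and>
     (\<forall>j\<in>{1..d}. prob_space (\<mu> j) \<and> space (\<mu> j) \<in> sets borel \<and>
        orthonormal_basis (\<mu> j) (\<phi> j) \<and>
        1 \<le> ess_bound (\<mu> j) (\<phi> j) \<and> ess_bound (\<mu> j) (\<phi> j) < \<infinity>)"

definition bound_const :: "nat \<Rightarrow> (nat \<Rightarrow> real measure) \<Rightarrow> (nat \<Rightarrow> nat \<Rightarrow> real \<Rightarrow> complex) \<Rightarrow> real" where
  "bound_const d \<mu> \<phi> = (\<Prod>j\<in>{1..d}. real_of_ereal (ess_bound (\<mu> j) (\<phi> j)))"

text \<open>Multi-indices over a coordinate set \<open>u\<close> are extensional functions, as are the points of
  \<open>space (PiM u \<mu>)\<close>; the part of \<open>h\<close> belonging to \<open>u\<close> is \<open>restrict h u\<close>.\<close>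

definition mindex :: "nat set \<Rightarrow> (nat \<Rightarrow> nat) set" where
  "mindex u = u \<rightarrow>\<^sub>E UNIV"

definition proj :: "nat set \<Rightarrow> (nat \<Rightarrow> nat) set \<Rightarrow> (nat \<Rightarrow> nat) set" where
  "proj u H = (\<lambda>h. restrict h u) ` H"

definition basis_fun ::
    "(nat \<Rightarrow> nat \<Rightarrow> real \<Rightarrow> complex) \<Rightarrow> nat set \<Rightarrow> (nat \<Rightarrow> nat) \<Rightarrow> (nat \<Rightarrow> real) \<Rightarrow> complex" where
  "basis_fun \<phi> u k x = (\<Prod>j\<in>u. \<phi> j (k j) (x j))"

definition smooth_enough ::
    "nat \<Rightarrow> (nat \<Rightarrow> real measure) \<Rightarrow> (nat \<Rightarrow> nat \<Rightarrow> real \<Rightarrow> complex) \<Rightarrow>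
     ((nat \<Rightarrow> nat) \<Rightarrow> complex) \<Rightarrow> ((nat \<Rightarrow> real) \<Rightarrow> complex) \<Rightarrow> bool" where
  "smooth_enough d \<mu> \<phi> c f \<longleftrightarrow>
     f \<in> L2 (PiM {1..d} \<mu>) \<and>
     (\<lambda>k. cmod (c k)) summable_on mindex {1..d} \<and>
     (\<forall>x\<in>space (PiM {1..d} \<mu>).
        ((\<lambda>k. c k * basis_fun \<phi> {1..d} k x) has_sum f x) (mindex {1..d}))"

definition large_indices :: "nat \<Rightarrow> ((nat \<Rightarrow> nat) \<Rightarrow> complex) \<Rightarrow> real \<Rightarrow> (nat \<Rightarrow> nat) set" where
  "large_indices d c \<theta> = {k \<in> mindex {1..d}. \<theta> \<le> cmod (c k)}"


section \<open>Cubature rules\<close>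

text \<open>A rule \<open>(M, w, \<xi>)\<close> has weights \<open>w j\<close> and nodes \<open>\<xi> j\<close> for \<open>j < M\<close>; the values at \<open>j \<ge> M\<close>
  are irrelevant. The measurable structure serves to speak of randomly constructed rules.\<close>

type_synonym cubature = "nat \<times> (nat \<Rightarrow> complex) \<times> (nat \<Rightarrow> nat \<Rightarrow> real)"

definition cubature_space :: "(nat \<Rightarrow> real measure) \<Rightarrow> nat set \<Rightarrow> cubature measure" where
  "cubature_space \<mu> u =
     count_space UNIV \<Otimes>\<^sub>M (PiM UNIV (\<lambda>_. borel) \<Otimes>\<^sub>M PiM UNIV (\<lambda>_. PiM u \<mu>))"

definition cub_pair ::
    "(nat \<Rightarrow> nat \<Rightarrow> real \<Rightarrow> complex) \<Rightarrow> nat set \<Rightarrow> cubature \<Rightarrow> (nat \<Rightarrow> nat) \<Rightarrow> (nat \<Rightarrow> nat) \<Rightarrow> complex" where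
  "cub_pair \<phi> u Q h k =
     (case Q of (M, w, \<xi>) \<Rightarrow> \<Sum>j<M. w j * basis_fun \<phi> u h (\<xi> j) * cnj (basis_fun \<phi> u k (\<xi> j)))"

definition cub_exact ::
    "(nat \<Rightarrow> nat \<Rightarrow> real \<Rightarrow> complex) \<Rightarrow> nat set \<Rightarrow> (nat \<Rightarrow> nat) set \<Rightarrow> cubature \<Rightarrow> bool" where
  "cub_exact \<phi> u K Q \<longleftrightarrow> (\<forall>k1\<in>K. \<forall>k2\<in>K. cub_pair \<phi> u Q k1 k2 = (if k1 = k2 then 1 else 0))"

definition cub_const :: "cubature \<Rightarrow> real" where
  "cub_const Q = (case Q of (M, w, \<xi>) \<Rightarrow> \<Sum>j<M. cmod (w j))"

definition proj_coeff ::
    "nat \<Rightarrow> (nat \<Rightarrow> nat \<Rightarrow> real \<Rightarrow> complex) \<Rightarrow> ((nat \<Rightarrow> real) \<Rightarrow> complex) \<Rightarrow> nat set \<Rightarrow> cubature \<Rightarrow>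
     (nat \<Rightarrow> real) \<Rightarrow> (nat \<Rightarrow> nat) \<Rightarrow> complex" where
  "proj_coeff d \<phi> f u Q x k =
     (case Q of (M, w, \<xi>) \<Rightarrow>
        \<Sum>j<M. w j * f (merge u ({1..d} - u) (\<xi> j, x)) * cnj (basis_fun \<phi> u k (\<xi> j)))"

definition proj_error ::
    "nat \<Rightarrow> (nat \<Rightarrow> nat \<Rightarrow> real \<Rightarrow> complex) \<Rightarrow> ((nat \<Rightarrow> nat) \<Rightarrow> complex) \<Rightarrow> (nat \<Rightarrow> nat) set \<Rightarrow>
     nat set \<Rightarrow> cubature \<Rightarrow> (nat \<Rightarrow> nat) \<Rightarrow> (nat \<Rightarrow> real) \<Rightarrow> complex" where
  "proj_error d \<phi> c J u Q k x =
     (\<Sum>\<^sub>\<infinity>h\<in>mindex {1..d} - J.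
        c h * basis_fun \<phi> ({1..d} - u) (restrict h ({1..d} - u)) x * cub_pair \<phi> u Q (restrict h u) k)"

text \<open>As an extended nonnegative integral, the \<open>L\<^sub>1\<close> norm is infinite rather than zero for a
  non-integrable error term. If \<open>u = {1..d}\<close>, the measure is the point mass on the empty product
  and the norm is an absolute value.\<close>

definition proj_error_L1 ::
    "nat \<Rightarrow> (nat \<Rightarrow> real measure) \<Rightarrow> (nat \<Rightarrow> nat \<Rightarrow> real \<Rightarrow> complex) \<Rightarrow> ((nat \<Rightarrow> nat) \<Rightarrow> complex) \<Rightarrow>
     (nat \<Rightarrow> nat) set \<Rightarrow> nat set \<Rightarrow> cubature \<Rightarrow> (nat \<Rightarrow> nat) \<Rightarrow> ennreal" where
  "proj_error_L1 d \<mu> \<phi> c J u Q k =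
     (\<integral>\<^sup>+x. ennreal (cmod (proj_error d \<phi> c J u Q k x)) \<partial>PiM ({1..d} - u) \<mu>)"


section \<open>The dimension-incremental algorithm\<close>

text \<open>\<open>rule1 P t\<close> is the cubature rule found in Step 1 for \<open>{t}\<close>. \<open>rule2 P t K z\<close> is the rule that
  the randomized procedure of Step 2 returns for \<open>{1..t}\<close> and the candidate set \<open>K\<close> when its
  internal random choices are \<open>z\<close>; the construction fails if this rule is not exact for \<open>K\<close>.
  \<open>prio P\<close> breaks ties between equally large coefficients.\<close>

record 'z dia_params =
  search :: "(nat \<Rightarrow> nat) set"
  sparsity :: nat
  sparsity_local :: nat
  threshold :: real
  iterations :: nat
  prio :: "(nat \<Rightarrow> nat) \<Rightarrow> nat"
  rule1 :: "nat \<Rightarrow> cubature"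
  rule2 :: "nat \<Rightarrow> (nat \<Rightarrow> nat) set \<Rightarrow> 'z \<Rightarrow> cubature"

definition valid_params ::
    "nat \<Rightarrow> (nat \<Rightarrow> real measure) \<Rightarrow> (nat \<Rightarrow> nat \<Rightarrow> real \<Rightarrow> complex) \<Rightarrow> 'z measure \<Rightarrow> 'z dia_params \<Rightarrow> bool" where
  "valid_params d \<mu> \<phi> S P \<longleftrightarrow>
     search P \<subseteq> mindex {1..d} \<and> finite (search P) \<and>
     sparsity P \<le> sparsity_local P \<and>
     0 < threshold P \<and>
     (\<forall>u\<subseteq>{1..d}. inj_on (prio P) (proj u (search P))) \<and>
     (\<forall>t\<in>{1..d}. rule1 P t \<in> space (cubature_space \<mu> {t}) \<and>
        cub_exact \<phi> {t} (proj {t} (search P)) (rule1 P t)) \<and>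
     (\<forall>t\<in>{2..d}. \<forall>K\<subseteq>proj {1..t} (search P). rule2 P t K \<in> S \<rightarrow>\<^sub>M cubature_space \<mu> {1..t})"

text \<open>The (up to) \<open>s\<close> largest of the values \<open>cmod (g k)\<close>, \<open>k \<in> K\<close>, that are at least \<open>\<theta>\<close>.\<close>

definition top_indices ::
    "((nat \<Rightarrow> nat) \<Rightarrow> nat) \<Rightarrow> real \<Rightarrow> nat \<Rightarrow> (nat \<Rightarrow> nat) set \<Rightarrow> ((nat \<Rightarrow> nat) \<Rightarrow> complex) \<Rightarrow> (nat \<Rightarrow> nat) set" where
  "top_indices p \<theta> s K g =
     {k \<in> K. \<theta> \<le> cmod (g k) \<and>
        card {k' \<in> K. cmod (g k) < cmod (g k') \<or> (cmod (g k') = cmod (g k) \<and> p k' < p k)} < s}"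

text \<open>A run is determined by the internal randomness \<open>z\<close> of the cubature constructions, with an
  arbitrary law \<open>S\<close>, and by the anchors: \<open>a (u, i)\<close> is the anchor of the \<open>i\<close>-th detection iteration
  for the coordinate set \<open>u\<close>. All draws are independent, hence the product measure. The component
  for \<open>{1..d}\<close> is the trivial element of an empty product.\<close>

type_synonym 'z run = "'z \<times> (nat set \<times> nat \<Rightarrow> nat \<Rightarrow> real)"

definition iters2 :: "nat \<Rightarrow> 'z dia_params \<Rightarrow> nat \<Rightarrow> nat" where
  "iters2 d P t = (if t < d then iterations P else 1)"

definition sparsity2 :: "nat \<Rightarrow> 'z dia_params \<Rightarrow> nat \<Rightarrow> nat" where
  "sparsity2 d P t = (if t < d then sparsity_local P else sparsity P)"

definition draws :: "nat \<Rightarrow> 'z dia_params \<Rightarrow> (nat set \<times> nat) set" where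
  "draws d P = {({t}, i) | t i. t \<in> {1..d} \<and> i < iterations P} \<union>
               {({1..t}, i) | t i. t \<in> {2..d} \<and> i < iters2 d P t}"

definition run_space ::
    "nat \<Rightarrow> (nat \<Rightarrow> real measure) \<Rightarrow> 'z measure \<Rightarrow> 'z dia_params \<Rightarrow> 'z run measure" where
  "run_space d \<mu> S P = S \<Otimes>\<^sub>M PiM (draws d P) (\<lambda>(u, i). PiM ({1..d} - u) \<mu>)"

definition detect1 ::
    "nat \<Rightarrow> (nat \<Rightarrow> nat \<Rightarrow> real \<Rightarrow> complex) \<Rightarrow> ((nat \<Rightarrow> real) \<Rightarrow> complex) \<Rightarrow> 'z dia_params \<Rightarrow>
     nat \<Rightarrow> nat \<Rightarrow> 'z run \<Rightarrow> (nat \<Rightarrow> nat) set" where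
  "detect1 d \<phi> f P t i \<omega> =
     top_indices (prio P) (threshold P) (sparsity_local P) (proj {t} (search P))
       (proj_coeff d \<phi> f {t} (rule1 P t) (snd \<omega> ({t}, i)))"

definition single_set ::
    "nat \<Rightarrow> (nat \<Rightarrow> nat \<Rightarrow> real \<Rightarrow> complex) \<Rightarrow> ((nat \<Rightarrow> real) \<Rightarrow> complex) \<Rightarrow> 'z dia_params \<Rightarrow>
     nat \<Rightarrow> 'z run \<Rightarrow> (nat \<Rightarrow> nat) set" where
  "single_set d \<phi> f P t \<omega> = (\<Union>i<iterations P. detect1 d \<phi> f P t i \<omega>)"

text \<open>\<open>(A \<times> B) \<inter> proj {1..t} \<Gamma>\<close> for \<open>A \<subseteq> mindex {1..t - 1}\<close>, \<open>B \<subseteq> mindex {t}\<close>.\<close>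

definition candidates ::
    "'z dia_params \<Rightarrow> nat \<Rightarrow> (nat \<Rightarrow> nat) set \<Rightarrow> (nat \<Rightarrow> nat) set \<Rightarrow> (nat \<Rightarrow> nat) set" where
  "candidates P t A B =
     {k \<in> proj {1..t} (search P). restrict k {1..t - 1} \<in> A \<and> restrict k {t} \<in> B}"

definition detect2 ::
    "nat \<Rightarrow> (nat \<Rightarrow> nat \<Rightarrow> real \<Rightarrow> complex) \<Rightarrow> ((nat \<Rightarrow> real) \<Rightarrow> complex) \<Rightarrow> 'z dia_params \<Rightarrow>
     nat \<Rightarrow> (nat \<Rightarrow> nat) set \<Rightarrow> nat \<Rightarrow> 'z run \<Rightarrow> (nat \<Rightarrow> nat) set" where
  "detect2 d \<phi> f P t K i \<omega> =
     top_indices (prio P) (threshold P) (sparsity2 d P t) K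
       (proj_coeff d \<phi> f {1..t} (rule2 P t K (fst \<omega>)) (snd \<omega> ({1..t}, i)))"

text \<open>The set detected for \<open>{1..t}\<close>. After a failed construction nothing is detected.\<close>

fun prefix_set ::
    "nat \<Rightarrow> (nat \<Rightarrow> nat \<Rightarrow> real \<Rightarrow> complex) \<Rightarrow> ((nat \<Rightarrow> real) \<Rightarrow> complex) \<Rightarrow> 'z dia_params \<Rightarrow>
     nat \<Rightarrow> 'z run \<Rightarrow> (nat \<Rightarrow> nat) set" where
  "prefix_set d \<phi> f P 0 \<omega> = {}"
| "prefix_set d \<phi> f P (Suc 0) \<omega> = single_set d \<phi> f P 1 \<omega>"
| "prefix_set d \<phi> f P (Suc (Suc n)) \<omega> =
     (let t = Suc (Suc n);
          K = candidates P t (prefix_set d \<phi> f P (Suc n) \<omega>) (single_set d \<phi> f P t \<omega>)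
      in if cub_exact \<phi> {1..t} K (rule2 P t K (fst \<omega>))
         then \<Union>i<iters2 d P t. detect2 d \<phi> f P t K i \<omega> else {})"

definition cand2 ::
    "nat \<Rightarrow> (nat \<Rightarrow> nat \<Rightarrow> real \<Rightarrow> complex) \<Rightarrow> ((nat \<Rightarrow> real) \<Rightarrow> complex) \<Rightarrow> 'z dia_params \<Rightarrow>
     nat \<Rightarrow> 'z run \<Rightarrow> (nat \<Rightarrow> nat) set" where
  "cand2 d \<phi> f P t \<omega> =
     candidates P t (prefix_set d \<phi> f P (t - 1) \<omega>) (single_set d \<phi> f P t \<omega>)"

definition used_rule2 ::
    "nat \<Rightarrow> (nat \<Rightarrow> nat \<Rightarrow> real \<Rightarrow> complex) \<Rightarrow> ((nat \<Rightarrow> real) \<Rightarrow> complex) \<Rightarrow> 'z dia_params \<Rightarrow>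
     nat \<Rightarrow> 'z run \<Rightarrow> cubature" where
  "used_rule2 d \<phi> f P t \<omega> = rule2 P t (cand2 d \<phi> f P t \<omega>) (fst \<omega>)"

definition constr_ok ::
    "nat \<Rightarrow> (nat \<Rightarrow> nat \<Rightarrow> real \<Rightarrow> complex) \<Rightarrow> ((nat \<Rightarrow> real) \<Rightarrow> complex) \<Rightarrow> 'z dia_params \<Rightarrow>
     nat \<Rightarrow> 'z run \<Rightarrow> bool" where
  "constr_ok d \<phi> f P t \<omega> \<longleftrightarrow>
     cub_exact \<phi> {1..t} (cand2 d \<phi> f P t \<omega>) (used_rule2 d \<phi> f P t \<omega>)"

definition output_set ::
    "nat \<Rightarrow> (nat \<Rightarrow> nat \<Rightarrow> real \<Rightarrow> complex) \<Rightarrow> ((nat \<Rightarrow> real) \<Rightarrow> complex) \<Rightarrow> 'z dia_params \<Rightarrow>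
     'z run \<Rightarrow> (nat \<Rightarrow> nat) set" where
  "output_set d \<phi> f P \<omega> = prefix_set d \<phi> f P d \<omega>"

text \<open>In no run of the algorithm does the cut-off to the largest coefficients discard an index
  of \<open>proj u J\<close> whose coefficient reaches the detection threshold.\<close>

definition cutoff_harmless ::
    "nat \<Rightarrow> (nat \<Rightarrow> real measure) \<Rightarrow> (nat \<Rightarrow> nat \<Rightarrow> real \<Rightarrow> complex) \<Rightarrow> ((nat \<Rightarrow> real) \<Rightarrow> complex) \<Rightarrow>
     'z measure \<Rightarrow> 'z dia_params \<Rightarrow> (nat \<Rightarrow> nat) set \<Rightarrow> bool" where
  "cutoff_harmless d \<mu> \<phi> f S P J \<longleftrightarrow>
     (\<forall>\<omega>\<in>space (run_space d \<mu> S P).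
        (\<forall>t\<in>{1..d}. \<forall>i<iterations P. \<forall>k\<in>proj {t} J.
           threshold P \<le> cmod (proj_coeff d \<phi> f {t} (rule1 P t) (snd \<omega> ({t}, i)) k) \<longrightarrow>
           k \<in> detect1 d \<phi> f P t i \<omega>) \<and>
        (\<forall>t\<in>{2..d}. constr_ok d \<phi> f P t \<omega> \<longrightarrow>
           (\<forall>i<iters2 d P t. \<forall>k\<in>cand2 d \<phi> f P t \<omega> \<inter> proj {1..t} J.
              threshold P \<le> cmod (proj_coeff d \<phi> f {1..t} (used_rule2 d \<phi> f P t \<omega>)
                                    (snd \<omega> ({1..t}, i)) k) \<longrightarrow>
              k \<in> detect2 d \<phi> f P t (cand2 d \<phi> f P t \<omega>) i \<omega>)))"

end

(* Exactness of the rule splits a projected coefficient into the finite sum of the c_h Phi_{u^c,h}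
   over the h in J that project to k, and the projection error. By orthonormality the L1 norm of the
   finite sum is at least max |c_h| / B, whereas it is bounded by B |J| max |c_h|; hence it cannot be
   small on a large set, and one anchor misses k with probability at most 1 - 2 / (3 B^2 |J|).
   The candidate set and the rule for {1..t} do not depend on the anchors for {1..t}, so the r misses
   are conditionally independent, and a union bound over all pairs (u, k) and all failures of the
   cubature construction concludes. *)
theory Submission
  imports Defs
begin

text \<open>The error is bounded only in L1, so first moments are compared, with the essential bound
  on the basis in place of a second moment. Origin of the constant: let a be the largest |c_h| in
  the fibre of k. The finite sum has L1 norm at least a / B and essential bound |J| a B. The
  threshold condition gives \<theta> + \<eta> \<le> a / (3 B), so 2 a / (3 B) of the mean is left;
  dividing by |J| a B cancels a. The obstacle in Step 2 is that candidate sets and rules are random: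
  they depend on a seed shared by all constructions and on earlier anchors. Moreover, the one-anchor
  bound needs an exact rule and candidates that contain all of \<open>proj {1..t} J\<close>. Both
  conditions are therefore built into the miss event; runs that violate them are charged to a failed
  construction or to an earlier miss. For d at least 2, detection on \<open>{1..d}\<close> has no
  random anchor and costs no probability. There remain three families of bad events with budget
  \<epsilon> / 3 each, whence the ln 3 in the bound on r.\<close>

lemma borel_measurable_cnj [measurable]: "cnj \<in> borel_measurable borel"
  by (intro borel_measurable_continuous_onI continuous_intros)

section \<open>Small values of a bounded function with large mean\<close>

text \<open>A reverse Markov inequality under an L1 perturbation. Where |g| < \<theta>, the triangle
  inequality gives |g0| \<le> \<theta> + |g - g0|; elsewhere |g0| \<le> K. Integrating, A \<le>
  \<theta> + \<eta> + K (1 - p) with p the probability in question.\<close>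

lemma (in prob_space) prob_small_le:
  fixes g g0 :: "'a \<Rightarrow> complex"
  assumes meas: "g \<in> borel_measurable M" "g0 \<in> borel_measurable M"
    and bound: "AE x in M. cmod (g0 x) \<le> K"
    and lower: "A \<le> (\<integral>x. cmod (g0 x) \<partial>M)"
    and err: "(\<integral>\<^sup>+x. ennreal (cmod (g x - g0 x)) \<partial>M) \<le> ennreal \<eta>"
    and pos: "0 \<le> \<eta>" "0 \<le> \<theta>" "0 \<le> K"
  shows "K * prob {x\<in>space M. cmod (g x) < \<theta>} \<le> K + \<theta> + \<eta> - A"
proof -
  define E where "E = {x\<in>space M. cmod (g x) < \<theta>}"
  have E [measurable]: "E \<in> sets M"
    unfolding E_def using meas by measurable
  note meas [measurable]
  have "integrable M (\<lambda>x. cmod (g0 x))"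
    using bound by (intro integrable_const_bound[where B=K]) auto
  then have "ennreal (\<integral>x. cmod (g0 x) \<partial>M) = (\<integral>\<^sup>+x. ennreal (cmod (g0 x)) \<partial>M)"
    by (intro nn_integral_eq_integral [symmetric]) auto
  also have "\<dots> \<le> (\<integral>\<^sup>+x. ennreal \<theta> + ennreal (cmod (g x - g0 x)) + ennreal K * indicator (space M - E) x \<partial>M)"
  proof (rule nn_integral_mono_AE)
    from bound AE_space
    show "AE x in M. ennreal (cmod (g0 x)) \<le> ennreal \<theta> + ennreal (cmod (g x - g0 x)) + ennreal K * indicator (space M - E) x"
    proof eventually_elim
      case (elim x)
      show ?case
      proof (cases "x \<in> E")
        case True
        have "cmod (g0 x) \<le> cmod (g x) + cmod (g x - g0 x)"
          by (metis norm_minus_commute norm_triangle_sub add.commute)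
        also have "\<dots> \<le> \<theta> + cmod (g x - g0 x)"
          using True by (simp add: E_def)
        finally show ?thesis
          using True pos by (simp flip: ennreal_plus add: ennreal_leI)
      next
        case False
        then have "ennreal (cmod (g0 x)) \<le> ennreal K * indicator (space M - E) x"
          using elim by (simp add: ennreal_leI)
        then show ?thesis
          by (simp add: add_increasing)
      qed
    qed
  qed
  also have "\<dots> = ennreal \<theta> + (\<integral>\<^sup>+x. ennreal (cmod (g x - g0 x)) \<partial>M) + ennreal K * emeasure M (space M - E)"
    by (subst nn_integral_add; simp add: nn_integral_add nn_integral_cmult emeasure_space_1)
  also have "\<dots> \<le> ennreal \<theta> + ennreal \<eta> + ennreal K * ennreal (prob (space M - E))"
    using err by (intro add_mono) (auto simp: emeasure_eq_measure)
  also have "\<dots> = ennreal (\<theta> + \<eta> + K * (1 - prob E))"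
    using pos by (simp add: prob_compl ennreal_mult)
  finally have "(\<integral>x. cmod (g0 x) \<partial>M) \<le> \<theta> + \<eta> + K * (1 - prob E)"
    using pos by (subst (asm) ennreal_le_iff) auto
  with lower show ?thesis
    by (simp add: E_def algebra_simps)
qed

section \<open>Tensor products of the bounded orthonormal bases\<close>

locale product_basis =
  fixes d :: nat and \<mu> :: "nat \<Rightarrow> real measure" and \<phi> :: "nat \<Rightarrow> nat \<Rightarrow> real \<Rightarrow> complex"
  assumes setting: "bounded_product_setting d \<mu> \<phi>"
begin

definition B where "B = bound_const d \<mu> \<phi>"

definition Bj where "Bj j = real_of_ereal (ess_bound (\<mu> j) (\<phi> j))"

lemma d_pos: "1 \<le> d"
  using setting by (simp add: bounded_product_setting_def)

lemma prob_space_coord: "j \<in> {1..d} \<Longrightarrow> prob_space (\<mu> j)"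
  using setting by (simp add: bounded_product_setting_def)

lemma prob_space_prod: "v \<subseteq> {1..d} \<Longrightarrow> prob_space (PiM v \<mu>)"
  by (intro prob_space_PiM prob_space_coord) auto

lemma basis_L2: "j \<in> {1..d} \<Longrightarrow> \<phi> j k \<in> L2 (\<mu> j)"
  using setting by (auto simp: bounded_product_setting_def orthonormal_basis_def)

lemma basis_measurable [measurable (raw)]: "j \<in> {1..d} \<Longrightarrow> \<phi> j k \<in> borel_measurable (\<mu> j)"
  using basis_L2[of j k] by (simp add: L2_def)

lemma basis_orthonormal:
  "j \<in> {1..d} \<Longrightarrow> (\<integral>x. \<phi> j k x * cnj (\<phi> j l x) \<partial>\<mu> j) = (if k = l then 1 else 0)"
  using setting by (auto simp: bounded_product_setting_def orthonormal_basis_def)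

lemma Bj_ge_1: "j \<in> {1..d} \<Longrightarrow> 1 \<le> Bj j"
  and ereal_Bj: "j \<in> {1..d} \<Longrightarrow> ereal (Bj j) = ess_bound (\<mu> j) (\<phi> j)"
proof -
  assume "j \<in> {1..d}"
  then have *: "1 \<le> ess_bound (\<mu> j) (\<phi> j)" "ess_bound (\<mu> j) (\<phi> j) < \<infinity>"
    using setting by (auto simp: bounded_product_setting_def)
  then show "1 \<le> Bj j" "ereal (Bj j) = ess_bound (\<mu> j) (\<phi> j)"
    unfolding Bj_def by (cases "ess_bound (\<mu> j) (\<phi> j)"; simp)+
qed

lemma basis_bound:
  assumes "j \<in> {1..d}"
  shows "AE x in \<mu> j. cmod (\<phi> j k x) \<le> Bj j"
proof -
  have "esssup (\<mu> j) (\<lambda>x. ereal (cmod (\<phi> j k x))) \<le> ereal (Bj j)"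
    unfolding ereal_Bj[OF assms] ess_bound_def by (rule SUP_upper) simp
  with esssup_AE[of "\<lambda>x. ereal (cmod (\<phi> j k x))" "\<mu> j"] show ?thesis
    by (auto elim!: eventually_mono) (metis ereal_less_eq(3) order_trans)
qed

lemma B_ge_1: "1 \<le> B"
  unfolding B_def bound_const_def by (intro prod_ge_1) (use Bj_ge_1 in \<open>simp add: Bj_def\<close>)

lemma basis_fun_measurable [measurable]:
  assumes "v \<subseteq> {1..d}"
  shows "basis_fun \<phi> v k \<in> borel_measurable (PiM v \<mu>)"
  unfolding basis_fun_def
proof (intro borel_measurable_prod)
  fix j assume "j \<in> v"
  then show "(\<lambda>x. \<phi> j (k j) (x j)) \<in> borel_measurable (PiM v \<mu>)"
    using assms by (intro measurable_compose[OF measurable_component_singleton[of j v]] basis_measurable) auto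
qed

text \<open>The factors missing from \<open>v\<close> have bounds \<open>Bj j\<close> of at least 1,
  so the constant of the full product serves every \<open>v\<close>.\<close>

lemma basis_fun_bound:
  assumes "v \<subseteq> {1..d}"
  shows "AE x in PiM v \<mu>. cmod (basis_fun \<phi> v k x) \<le> B"
proof -
  have fin: "finite v"
    using assms finite_subset by blast
  have "AE x in PiM v \<mu>. \<forall>j\<in>v. cmod (\<phi> j (k j) (x j)) \<le> Bj j"
    using fin assms by (intro AE_finite_allI AE_PiM_component basis_bound) (use assms prob_space_coord in auto)
  then show ?thesis
  proof eventually_elim
    case (elim x)
    have "cmod (basis_fun \<phi> v k x) \<le> (\<Prod>j\<in>v. Bj j)"
      unfolding basis_fun_def prod_norm [symmetric] using elim by (intro prod_mono) auto
    also have "\<dots> \<le> (\<Prod>j\<in>{1..d}. Bj j)"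
    proof (rule prod_mono2)
      show "0 \<le> Bj j" if "j \<in> v" for j
        using Bj_ge_1[of j] that assms by auto
    qed (use assms Bj_ge_1 in auto)
    finally show ?case
      by (simp add: B_def bound_const_def Bj_def)
  qed
qed

lemma basis_fun_cong: "(\<And>j. j \<in> v \<Longrightarrow> k j = l j) \<Longrightarrow> basis_fun \<phi> v k = basis_fun \<phi> v l"
  by (auto simp: basis_fun_def fun_eq_iff intro!: prod.cong)

lemma integrable_bounded_basis_fun:
  assumes "v \<subseteq> {1..d}" and [measurable]: "g \<in> borel_measurable (PiM v \<mu>)"
    and "integrable (PiM v \<mu>) g"
  shows "integrable (PiM v \<mu>) (\<lambda>x. g x * cnj (basis_fun \<phi> v l x))"
proof (rule Bochner_Integration.integrable_bound[where f="\<lambda>x. B * cmod (g x)"])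
  note [measurable] = basis_fun_measurable[OF assms(1)]
  show "(\<lambda>x. g x * cnj (basis_fun \<phi> v l x)) \<in> borel_measurable (PiM v \<mu>)"
    by measurable
  show "AE x in PiM v \<mu>. norm (g x * cnj (basis_fun \<phi> v l x)) \<le> norm (B * cmod (g x))"
    using basis_fun_bound[OF assms(1), of l]
    by eventually_elim
      (use B_ge_1 in \<open>simp add: norm_mult mult.commute[of _ "cmod (g _)"] mult_left_mono\<close>)
qed (use assms in auto)

lemma integrable_basis_fun: "v \<subseteq> {1..d} \<Longrightarrow> integrable (PiM v \<mu>) (basis_fun \<phi> v k)"
  using basis_fun_bound[of v k] prob_space.finite_measure[OF prob_space_prod[of v]]
  by (intro finite_measure.integrable_const_bound[where B=B])
    (auto intro: basis_fun_measurable)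

lemma basis_fun_orthonormal:
  assumes v: "v \<subseteq> {1..d}"
  shows "(\<integral>x. basis_fun \<phi> v k x * cnj (basis_fun \<phi> v l x) \<partial>PiM v \<mu>)
           = (if \<forall>j\<in>v. k j = l j then 1 else 0)"
proof -
  \<comment> \<open>\<open>product_prob_space\<close> wants a probability space at every index,
    whereas \<open>\<mu>\<close> is constrained only on \<open>{1..d}\<close>; the filler
    \<open>\<mu> 1\<close> exists because d is at least 1.\<close>
  define M where "M j = (if j \<in> {1..d} then \<mu> j else \<mu> 1)" for j
  have ps: "prob_space (M j)" for j
    using d_pos prob_space_coord by (auto simp: M_def)
  interpret product_prob_space M v
    by (intro product_prob_space.intro product_sigma_finite.intro product_prob_space_axioms.intro)
      (auto intro: ps prob_space_imp_sigma_finite)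
  have fin: "finite v"
    using v finite_subset by blast
  have int: "integrable (M j) (\<lambda>x. \<phi> j (k j) x * cnj (\<phi> j (l j) x))" if "j \<in> v" for j
  proof -
    have j: "j \<in> {1..d}" and Mj: "M j = \<mu> j"
      using that v by (auto simp: M_def)
    note [measurable] = basis_measurable[OF j]
    interpret prob_space "\<mu> j" by (rule prob_space_coord[OF j])
    have "AE x in \<mu> j. norm (\<phi> j (k j) x * cnj (\<phi> j (l j) x)) \<le> Bj j * Bj j"
      using basis_bound[OF j, of "k j"] basis_bound[OF j, of "l j"]
      by eventually_elim (use Bj_ge_1[OF j] in \<open>simp add: norm_mult mult_mono\<close>)
    then show ?thesis
      unfolding Mj by (intro integrable_const_bound) auto
  qed
  have "PiM v \<mu> = PiM v M"
    using v by (intro PiM_cong) (auto simp: M_def)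
  then have "(\<integral>x. basis_fun \<phi> v k x * cnj (basis_fun \<phi> v l x) \<partial>PiM v \<mu>)
      = (\<integral>x. (\<Prod>j\<in>v. \<phi> j (k j) (x j) * cnj (\<phi> j (l j) (x j))) \<partial>PiM v M)"
    by (simp add: basis_fun_def prod.distrib)
  also have "\<dots> = (\<Prod>j\<in>v. \<integral>x. \<phi> j (k j) x * cnj (\<phi> j (l j) x) \<partial>M j)"
    by (rule product_integral_prod[OF fin int])
  also have "\<dots> = (\<Prod>j\<in>v. if k j = l j then 1 else 0)"
    using v by (intro prod.cong) (auto simp: M_def basis_orthonormal)
  also have "\<dots> = (if \<forall>j\<in>v. k j = l j then 1 else 0)"
    using fin by (auto simp: prod_zero_iff intro!: prod.neutral)
  finally show ?thesis .
qed

text \<open>\<open>c h0\<close> is the inner product of the sum with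
  \<open>basis_fun \<phi> v h0\<close>, and that function is essentially bounded by B. Injectivity
  of the restriction makes the other summands orthogonal to it, although indices are compared on
  \<open>v\<close> only.\<close>

lemma coeff_le_L1:
  assumes v: "v \<subseteq> {1..d}" and fin: "finite F" and inj: "inj_on (\<lambda>h. restrict h v) F" and h0: "h0 \<in> F"
  shows "cmod (c h0) \<le> B * (\<integral>x. cmod (\<Sum>h\<in>F. c h * basis_fun \<phi> v h x) \<partial>PiM v \<mu>)"
proof -
  let ?g = "\<lambda>x. \<Sum>h\<in>F. c h * basis_fun \<phi> v h x"
  note [measurable] = basis_fun_measurable[OF v]
  have int: "integrable (PiM v \<mu>) ?g"
    using integrable_basis_fun[OF v] by auto
  have eq: "(\<forall>j\<in>v. h j = h0 j) \<longleftrightarrow> h = h0" if "h \<in> F" for h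
    using inj_onD[OF inj _ that h0] by (metis restrict_ext)
  have "(\<integral>x. ?g x * cnj (basis_fun \<phi> v h0 x) \<partial>PiM v \<mu>)
      = (\<integral>x. (\<Sum>h\<in>F. c h * (basis_fun \<phi> v h x * cnj (basis_fun \<phi> v h0 x))) \<partial>PiM v \<mu>)"
    by (simp add: sum_distrib_right mult.assoc)
  also have "\<dots> = (\<Sum>h\<in>F. c h * (if h = h0 then 1 else 0))"
    using integrable_bounded_basis_fun[OF v _ integrable_basis_fun[OF v]]
    by (subst Bochner_Integration.integral_sum)
      (auto simp: basis_fun_orthonormal[OF v] eq intro!: sum.cong)
  also have "\<dots> = c h0"
    using fin h0 by (simp add: if_distrib[where f="\<lambda>x. _ * x"] cong: if_cong)
  finally have "cmod (c h0) = norm (\<integral>x. ?g x * cnj (basis_fun \<phi> v h0 x) \<partial>PiM v \<mu>)"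
    by simp
  also have "\<dots> \<le> (\<integral>x. norm (?g x * cnj (basis_fun \<phi> v h0 x)) \<partial>PiM v \<mu>)"
    by (rule integral_norm_bound)
  also have "\<dots> \<le> (\<integral>x. B * cmod (?g x) \<partial>PiM v \<mu>)"
  proof (rule integral_mono_AE)
    show "integrable (PiM v \<mu>) (\<lambda>x. norm (?g x * cnj (basis_fun \<phi> v h0 x)))"
      using int by (intro integrable_norm integrable_bounded_basis_fun[OF v]) auto
    show "integrable (PiM v \<mu>) (\<lambda>x. B * cmod (?g x))"
      using int by auto
    show "AE x in PiM v \<mu>. norm (?g x * cnj (basis_fun \<phi> v h0 x)) \<le> B * cmod (?g x)"
      using basis_fun_bound[OF v, of h0]
      by eventually_elim (simp add: norm_mult mult.commute[of B] mult_left_mono)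
  qed
  finally show ?thesis
    by simp
qed

end

section \<open>Projected coefficients: measurability and series expansion\<close>

lemma has_sum_sum:
  fixes F :: "'i \<Rightarrow> 'a \<Rightarrow> complex"
  assumes "finite I" "\<And>i. i \<in> I \<Longrightarrow> (F i has_sum s i) A"
  shows "((\<lambda>x. \<Sum>i\<in>I. F i x) has_sum (\<Sum>i\<in>I. s i)) A"
  using assms by (induction rule: finite_induct) (auto intro: has_sum_add has_sum_0)

text \<open>The number of nodes is part of a randomly constructed rule; the sum is treated
  separately on each of the countably many events fixing that number.\<close>

lemma borel_measurable_sum_lessThan:
  fixes F :: "nat \<Rightarrow> 'a \<Rightarrow> complex"
  assumes "n \<in> M \<rightarrow>\<^sub>M count_space UNIV" "\<And>j. F j \<in> borel_measurable M"
  shows "(\<lambda>x. \<Sum>j<n x. F j x) \<in> borel_measurable M"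
  using assms by (intro measurable_compose_countable[where g=n and f="\<lambda>m x. \<Sum>j<m. F j x"]) auto

lemma
  shows measurable_cub_size: "(\<lambda>Q. fst Q) \<in> cubature_space \<mu> u \<rightarrow>\<^sub>M count_space UNIV"
    and measurable_cub_weight: "(\<lambda>Q. fst (snd Q) j) \<in> borel_measurable (cubature_space \<mu> u)"
    and measurable_cub_node: "(\<lambda>Q. snd (snd Q) j) \<in> cubature_space \<mu> u \<rightarrow>\<^sub>M PiM u \<mu>"
  unfolding cubature_space_def by measurable

locale product_expansion = product_basis +
  fixes c :: "(nat \<Rightarrow> nat) \<Rightarrow> complex" and f :: "(nat \<Rightarrow> real) \<Rightarrow> complex"
  assumes smooth: "smooth_enough d \<mu> \<phi> c f"
begin

lemma f_measurable: "f \<in> borel_measurable (PiM {1..d} \<mu>)"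
  using smooth by (simp add: smooth_enough_def L2_def)

lemma has_sum_f:
  "x \<in> space (PiM {1..d} \<mu>) \<Longrightarrow> ((\<lambda>k. c k * basis_fun \<phi> {1..d} k x) has_sum f x) (mindex {1..d})"
  using smooth by (simp add: smooth_enough_def)

lemma cub_pair_measurable:
  assumes u: "u \<subseteq> {1..d}"
  shows "(\<lambda>Q. cub_pair \<phi> u Q h k) \<in> borel_measurable (cubature_space \<mu> u)"
proof -
  note [measurable] = measurable_cub_weight
    measurable_compose[OF measurable_cub_node basis_fun_measurable[OF u]]
  show ?thesis
    unfolding cub_pair_def case_prod_beta
    by (intro borel_measurable_sum_lessThan measurable_cub_size) measurable
qed

text \<open>Joint measurability in rule and anchor is needed because both are random in Step
  2.\<close>

lemma proj_coeff_measurable: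
  assumes u: "u \<subseteq> {1..d}"
  shows "(\<lambda>p. proj_coeff d \<phi> f u (fst p) (snd p) k)
           \<in> borel_measurable (cubature_space \<mu> u \<Otimes>\<^sub>M PiM ({1..d} - u) \<mu>)"
proof -
  let ?N = "cubature_space \<mu> u \<Otimes>\<^sub>M PiM ({1..d} - u) \<mu>"
  note [measurable] = measurable_cub_weight measurable_cub_node basis_fun_measurable[OF u]
  have "u \<union> ({1..d} - u) = {1..d}"
    using u by auto
  then have "merge u ({1..d} - u) \<in> PiM u \<mu> \<Otimes>\<^sub>M PiM ({1..d} - u) \<mu> \<rightarrow>\<^sub>M PiM {1..d} \<mu>"
    using measurable_merge[of u "{1..d} - u" \<mu>] by simp
  from measurable_compose[OF this f_measurable]
  have [measurable]: "(\<lambda>y. f (merge u ({1..d} - u) y)) \<in> borel_measurable (PiM u \<mu> \<Otimes>\<^sub>M PiM ({1..d} - u) \<mu>)" .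
  have [measurable]: "(\<lambda>p. snd (snd (fst p)) j) \<in> ?N \<rightarrow>\<^sub>M PiM u \<mu>" for j
    by (rule measurable_compose[OF measurable_fst measurable_cub_node])
  have [measurable]: "(\<lambda>p. fst (snd (fst p)) j) \<in> borel_measurable ?N" for j
    by (rule measurable_compose[OF measurable_fst measurable_cub_weight])
  have "(\<lambda>p. (snd (snd (fst p)) j, snd p)) \<in> ?N \<rightarrow>\<^sub>M PiM u \<mu> \<Otimes>\<^sub>M PiM ({1..d} - u) \<mu>" for j
    by measurable
  note [measurable] = measurable_compose[OF this \<open>(\<lambda>y. f (merge _ _ y)) \<in> _\<close>]
  have [measurable]: "(\<lambda>p. basis_fun \<phi> u k (snd (snd (fst p)) j)) \<in> borel_measurable ?N" for j
    by (rule measurable_compose[OF _ basis_fun_measurable[OF u]]) measurable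
  show ?thesis
    unfolding proj_coeff_def case_prod_beta
    by (intro borel_measurable_sum_lessThan measurable_compose[OF measurable_fst measurable_cub_size])
      measurable
qed

lemma basis_fun_merge:
  assumes u: "u \<subseteq> {1..d}"
  shows "basis_fun \<phi> {1..d} h (merge u ({1..d} - u) (\<xi>, x))
           = basis_fun \<phi> u h \<xi> * basis_fun \<phi> ({1..d} - u) h x"
proof -
  have "basis_fun \<phi> {1..d} h y = basis_fun \<phi> ({1..d} - u) h y * basis_fun \<phi> u h y" for y
    unfolding basis_fun_def by (rule prod.subset_diff) (use u in auto)
  moreover have "basis_fun \<phi> u h (merge u ({1..d} - u) (\<xi>, x)) = basis_fun \<phi> u h \<xi>"
    "basis_fun \<phi> ({1..d} - u) h (merge u ({1..d} - u) (\<xi>, x)) = basis_fun \<phi> ({1..d} - u) h x"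
    by (auto simp: basis_fun_def merge_def intro!: prod.cong)
  ultimately show ?thesis
    by (simp add: mult.commute)
qed

lemma cub_pair_restrict [simp]: "cub_pair \<phi> u Q (restrict h u) k = cub_pair \<phi> u Q h k"
  using basis_fun_cong[of u "restrict h u" h] by (simp add: cub_pair_def)

lemma basis_fun_restrict [simp]: "basis_fun \<phi> v (restrict h v) = basis_fun \<phi> v h"
  by (rule basis_fun_cong) simp

text \<open>The series represents f at every point and not just almost everywhere, so it may be
  evaluated at the nodes merged with the anchor; the finite sum over the nodes then commutes with
  the series.\<close>

lemma has_sum_proj_coeff:
  assumes u: "u \<subseteq> {1..d}" and Q: "Q \<in> space (cubature_space \<mu> u)"
    and x: "x \<in> space (PiM ({1..d} - u) \<mu>)"
  shows "((\<lambda>h. c h * basis_fun \<phi> ({1..d} - u) h x * cub_pair \<phi> u Q h k)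
           has_sum proj_coeff d \<phi> f u Q x k) (mindex {1..d})"
proof -
  obtain M w \<xi> where Q_eq: "Q = (M, w, \<xi>)"
    by (cases Q)
  define y where "y j = merge u ({1..d} - u) (\<xi> j, x)" for j
  have y: "y j \<in> space (PiM {1..d} \<mu>)" for j
  proof -
    have "\<xi> j \<in> space (PiM u \<mu>)"
      using measurable_space[OF measurable_cub_node Q, of j] by (simp add: Q_eq)
    then have "y j \<in> space (PiM (u \<union> ({1..d} - u)) \<mu>)"
      unfolding y_def by (intro measurable_space[OF measurable_merge]) (use x in \<open>simp add: space_pair_measure\<close>)
    moreover have "u \<union> ({1..d} - u) = {1..d}"
      using u by auto
    ultimately show ?thesis
      by simp
  qed
  have "((\<lambda>h. \<Sum>j<M. w j * (c h * basis_fun \<phi> {1..d} h (y j)) * cnj (basis_fun \<phi> u k (\<xi> j)))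
           has_sum (\<Sum>j<M. w j * f (y j) * cnj (basis_fun \<phi> u k (\<xi> j)))) (mindex {1..d})"
    by (intro has_sum_sum has_sum_cmult_left has_sum_cmult_right has_sum_f y) auto
  also have "(\<lambda>h. \<Sum>j<M. w j * (c h * basis_fun \<phi> {1..d} h (y j)) * cnj (basis_fun \<phi> u k (\<xi> j)))
      = (\<lambda>h. c h * basis_fun \<phi> ({1..d} - u) h x * cub_pair \<phi> u Q h k)"
    unfolding y_def basis_fun_merge[OF u]
    by (simp add: Q_eq cub_pair_def sum_distrib_left mult_ac)
  finally show ?thesis
    by (simp add: proj_coeff_def Q_eq y_def)
qed

lemma proj_coeff_split:
  assumes u: "u \<subseteq> {1..d}" and Q: "Q \<in> space (cubature_space \<mu> u)"
    and x: "x \<in> space (PiM ({1..d} - u) \<mu>)"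
    and J: "finite J" "J \<subseteq> mindex {1..d}" "proj u J \<subseteq> K"
    and exact: "cub_exact \<phi> u K Q" and k: "k \<in> K"
  shows "proj_coeff d \<phi> f u Q x k =
           (\<Sum>h\<in>{h\<in>J. restrict h u = k}. c h * basis_fun \<phi> ({1..d} - u) h x)
           + proj_error d \<phi> c J u Q k x"
proof -
  let ?s = "\<lambda>h. c h * basis_fun \<phi> ({1..d} - u) h x * cub_pair \<phi> u Q h k"
  have "(?s has_sum (\<Sum>h\<in>J. ?s h)) J"
    using J by (intro has_sum_finite)
  from has_sum_Diff[OF has_sum_proj_coeff[OF u Q x] this] J
  have "(?s has_sum (proj_coeff d \<phi> f u Q x k - (\<Sum>h\<in>J. ?s h))) (mindex {1..d} - J)"
    by simp
  from infsumI[OF this]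
  have *: "proj_error d \<phi> c J u Q k x = proj_coeff d \<phi> f u Q x k - (\<Sum>h\<in>J. ?s h)"
    by (simp add: proj_error_def)
  \<comment> \<open>Exactness applies to the pair \<open>restrict h u\<close>, \<open>k\<close>:
    both lie in K, the former because \<open>proj u J \<subseteq> K\<close>.\<close>
  have "cub_pair \<phi> u Q h k = (if restrict h u = k then 1 else 0)" if "h \<in> J" for h
    using exact k J that unfolding cub_exact_def proj_def
    by (metis cub_pair_restrict imageI subsetD)
  then have "(\<Sum>h\<in>J. ?s h) = (\<Sum>h\<in>J. if restrict h u = k then c h * basis_fun \<phi> ({1..d} - u) h x else 0)"
    by (intro sum.cong) auto
  also have "\<dots> = (\<Sum>h\<in>{h\<in>J. restrict h u = k}. c h * basis_fun \<phi> ({1..d} - u) h x)"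
    using J by (subst sum.inter_filter) auto
  finally show ?thesis
    using * by simp
qed

section \<open>Detection with a single anchor\<close>

text \<open>\<open>prob_small_le\<close> is applied with A = a / B and K = |J| a B, where a is the
  maximum over the fibre of k. Taking the maximum makes the same a appear in the lower bound of the
  mean and in the upper bound of the values, so the result depends neither on the coefficients nor
  on k.\<close>

lemma miss_prob_le:
  assumes u: "u \<subseteq> {1..d}" and Q: "Q \<in> space (cubature_space \<mu> u)"
    and J: "finite J" "J \<subseteq> mindex {1..d}" "proj u J \<subseteq> K"
    and exact: "cub_exact \<phi> u K Q" and k: "k \<in> proj u J"
    and err: "proj_error_L1 d \<mu> \<phi> c J u Q k < ennreal \<eta>"
    and \<theta>: "0 \<le> \<theta>" "3 * B * (\<theta> + \<eta>) < Min ((\<lambda>k. cmod (c k)) ` J)"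
  shows "measure (PiM ({1..d} - u) \<mu>)
           {x\<in>space (PiM ({1..d} - u) \<mu>). cmod (proj_coeff d \<phi> f u Q x k) < \<theta>}
         \<le> 1 - 2 / (3 * B\<^sup>2 * real (card J))"
proof -
  define v where "v = {1..d} - u"
  have v: "v \<subseteq> {1..d}"
    by (auto simp: v_def)
  interpret prob_space "PiM v \<mu>"
    by (rule prob_space_prod[OF v])
  define F where "F = {h\<in>J. restrict h u = k}"
  have F: "finite F" "F \<noteq> {}" "F \<subseteq> J"
    using J k by (auto simp: F_def proj_def)
  define a where "a = Max ((\<lambda>h. cmod (c h)) ` F)"
  have a_ge: "cmod (c h) \<le> a" if "h \<in> F" for h
    using F that by (simp add: a_def)
  have "a \<in> (\<lambda>h. cmod (c h)) ` F"
    unfolding a_def using F by (intro Max_in) auto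
  then obtain h0 where h0: "h0 \<in> F" "a = cmod (c h0)"
    by auto
  \<comment> \<open>The strict inequality \<open>err\<close> puts \<open>ennreal \<eta>\<close>
    above 0, and \<open>ennreal\<close> sends nonpositive reals to 0.\<close>
  have \<eta>: "0 < \<eta>"
    using le_less_trans[OF zero_le err] by simp
  have "Min ((\<lambda>k. cmod (c k)) ` J) \<le> a"
    using h0 F J by (auto intro!: Min_le)
  with \<theta> have \<theta>_less: "3 * B * (\<theta> + \<eta>) < a"
    by linarith
  have "0 < 3 * B * (\<theta> + \<eta>)"
    using \<eta> \<theta> B_ge_1 by simp
  with \<theta>_less have a: "0 < a"
    by linarith
  define g0 where "g0 = (\<lambda>x. \<Sum>h\<in>F. c h * basis_fun \<phi> v h x)"
  \<comment> \<open>Members of the fibre agree on \<open>u\<close> and are extensional, so they are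
    told apart by their coordinates in \<open>v\<close>.\<close>
  have inj: "inj_on (\<lambda>h. restrict h v) F"
  proof (rule inj_onI)
    fix h h' assume hh: "h \<in> F" "h' \<in> F" and eq: "restrict h v = restrict h' v"
    have "restrict h u = restrict h' u"
      using hh by (simp add: F_def)
    moreover have "h \<in> extensional {1..d}" "h' \<in> extensional {1..d}"
      using hh F J by (auto simp: mindex_def PiE_def)
    ultimately show "h = h'"
      using eq by (intro extensionalityI) (auto simp: v_def restrict_def fun_eq_iff split: if_splits)
  qed
  have g0_meas: "g0 \<in> borel_measurable (PiM v \<mu>)"
    unfolding g0_def using basis_fun_measurable[OF v] by measurable
  have Qx: "(\<lambda>x. (Q, x)) \<in> PiM v \<mu> \<rightarrow>\<^sub>M cubature_space \<mu> u \<Otimes>\<^sub>M PiM v \<mu>"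
    using Q by measurable
  have g_meas: "(\<lambda>x. proj_coeff d \<phi> f u Q x k) \<in> borel_measurable (PiM v \<mu>)"
    using measurable_compose[OF Qx proj_coeff_measurable[OF u, of k, folded v_def]] by simp
  \<comment> \<open>The fibre is bounded in size by all of J, to get one constant for every
    k.\<close>
  have bound: "AE x in PiM v \<mu>. cmod (g0 x) \<le> real (card J) * (a * B)"
  proof -
    have "AE x in PiM v \<mu>. \<forall>h\<in>F. cmod (basis_fun \<phi> v h x) \<le> B"
      using F by (intro AE_finite_allI basis_fun_bound v)
    then show ?thesis
    proof eventually_elim
      case (elim x)
      have "cmod (g0 x) \<le> (\<Sum>h\<in>F. a * B)"
        unfolding g0_def using elim a_ge a
        by (intro sum_norm_le) (auto simp: norm_mult intro!: mult_mono)
      also have "\<dots> \<le> real (card J) * (a * B)"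
        using card_mono[of J F] F J a B_ge_1 by (simp add: mult_right_mono)
      finally show ?case .
    qed
  qed
  have lower: "a / B \<le> (\<integral>x. cmod (g0 x) \<partial>PiM v \<mu>)"
    using coeff_le_L1[OF v F(1) inj h0(1), of c] B_ge_1
    by (simp add: g0_def h0(2) field_simps)
  have "(\<integral>\<^sup>+x. ennreal (cmod (proj_coeff d \<phi> f u Q x k - g0 x)) \<partial>PiM v \<mu>)
      = proj_error_L1 d \<mu> \<phi> c J u Q k"
    unfolding proj_error_L1_def v_def [symmetric]
  proof (intro nn_integral_cong)
    fix x assume "x \<in> space (PiM v \<mu>)"
    from proj_coeff_split[OF u Q this[unfolded v_def] J exact, of k] k J
    show "ennreal (cmod (proj_coeff d \<phi> f u Q x k - g0 x)) = ennreal (cmod (proj_error d \<phi> c J u Q k x))"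
      by (auto simp: g0_def F_def v_def)
  qed
  with err have err': "(\<integral>\<^sup>+x. ennreal (cmod (proj_coeff d \<phi> f u Q x k - g0 x)) \<partial>PiM v \<mu>) \<le> ennreal \<eta>"
    by simp
  define p where "p = prob {x\<in>space (PiM v \<mu>). cmod (proj_coeff d \<phi> f u Q x k) < \<theta>}"
  define N where "N = real (card J)"
  have N: "0 < N"
    using F J by (auto simp: N_def card_gt_0_iff)
  have "N * (a * B) * p \<le> N * (a * B) + \<theta> + \<eta> - a / B"
    unfolding p_def N_def
    by (rule prob_small_le[OF g_meas g0_meas bound lower err']) (use \<eta> \<theta> a B_ge_1 in auto)
  \<comment> \<open>Threshold and error together use up at most a third of the mean a / B.\<close>
  also have "\<dots> \<le> N * (a * B) - 2 * a / (3 * B)"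
  proof -
    have "\<theta> + \<eta> \<le> a / (3 * B)"
      using \<theta>_less B_ge_1 by (simp add: field_simps)
    moreover have "a / B - a / (3 * B) = 2 * a / (3 * B)"
      using B_ge_1 by (simp add: field_simps)
    ultimately show ?thesis
      by linarith
  qed
  also have "\<dots> = N * (a * B) * (1 - 2 / (3 * B\<^sup>2 * N))"
    using N a B_ge_1 by (simp add: field_simps power2_eq_square)
  finally have "p \<le> 1 - 2 / (3 * B\<^sup>2 * N)"
    using N a B_ge_1 by (subst (asm) mult_le_cancel_left_pos) auto
  then show ?thesis
    by (simp add: p_def N_def v_def)
qed

text \<open>Without complementary coordinates the fibre of k is the singleton of k, and integration
  is evaluation at the only point of the empty product. The L1 bound is thus a pointwise one, and
  the coefficient is \<open>c k\<close> plus an error below \<eta>. The threshold is then exceeded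
  with certainty, since 3 B \<ge> 1.\<close>

lemma full_coeff_ge:
  assumes Q: "Q \<in> space (cubature_space \<mu> {1..d})" and x: "x \<in> space (PiM ({1..d} - {1..d}) \<mu>)"
    and J: "finite J" "J \<subseteq> mindex {1..d}" "proj {1..d} J \<subseteq> K"
    and exact: "cub_exact \<phi> {1..d} K Q" and k: "k \<in> proj {1..d} J"
    and err: "proj_error_L1 d \<mu> \<phi> c J {1..d} Q k < ennreal \<eta>"
    and \<theta>: "0 \<le> \<theta>" "3 * B * (\<theta> + \<eta>) < Min ((\<lambda>k. cmod (c k)) ` J)"
  shows "\<theta> \<le> cmod (proj_coeff d \<phi> f {1..d} Q x k)"
proof -
  have \<eta>: "0 < \<eta>"
    using le_less_trans[OF zero_le err] by simp
  have rJ: "restrict h {1..d} = h" if "h \<in> J" for h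
    using that J(2) by (intro PiE_restrict[of h _ "\<lambda>_. UNIV"]) (auto simp: mindex_def)
  then have kJ: "k \<in> J"
    using k by (auto simp: proj_def)
  have "{h\<in>J. restrict h {1..d} = k} = {k}"
    using rJ kJ by auto
  then have eq: "proj_coeff d \<phi> f {1..d} Q x k = c k + proj_error d \<phi> c J {1..d} Q k x"
    using proj_coeff_split[OF _ Q x J exact, of k] k J(3) by (auto simp: basis_fun_def)
  have "x = (\<lambda>_. undefined)"
    using x by (simp add: space_PiM)
  then have "proj_error_L1 d \<mu> \<phi> c J {1..d} Q k = ennreal (cmod (proj_error d \<phi> c J {1..d} Q k x))"
    by (simp add: proj_error_L1_def PiM_empty nn_integral_count_space_finite)
  with err \<eta> have "cmod (proj_error d \<phi> c J {1..d} Q k x) < \<eta>"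
    by (simp add: ennreal_less_iff)
  moreover have "\<theta> + \<eta> < cmod (c k)"
  proof -
    have "1 * (\<theta> + \<eta>) \<le> 3 * B * (\<theta> + \<eta>)"
      using B_ge_1 \<theta>(1) \<eta> by (intro mult_right_mono) auto
    also note \<theta>(2)
    also have "Min ((\<lambda>k. cmod (c k)) ` J) \<le> cmod (c k)"
      using J kJ by (intro Min_le) auto
    finally show ?thesis
      by simp
  qed
  moreover have "cmod (c k) - cmod (proj_error d \<phi> c J {1..d} Q k x) \<le> cmod (proj_coeff d \<phi> f {1..d} Q x k)"
    unfolding eq by (rule norm_diff_ineq)
  ultimately show ?thesis
    by simp
qed

end

section \<open>Repeated misses in a product space\<close>

text \<open>\<open>E\<close> may depend on \<open>z\<close> and on the coordinates outside \<open>I0\<close>; the bound is a product over \<open>I0\<close>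
  once these are fixed.\<close>

lemma iterated_miss_le:
  fixes A :: "('z \<times> ('i \<Rightarrow> 'b)) set"
  assumes S: "prob_space S" and I: "finite I" "I0 \<subseteq> I" and M: "\<And>i. prob_space (M i)"
    and A: "A \<in> sets (S \<Otimes>\<^sub>M PiM I M)" and q: "0 \<le> q"
    and miss: "\<And>z a. (z, a) \<in> A \<Longrightarrow> \<exists>E. \<forall>i\<in>I0. E i \<in> sets (M i) \<and> measure (M i) (E i) \<le> q \<and>
                 (\<forall>a'. (z, a') \<in> A \<longrightarrow> (\<forall>j\<in>I - I0. a' j = a j) \<longrightarrow> a' i \<in> E i)"
  shows "measure (S \<Otimes>\<^sub>M PiM I M) A \<le> q ^ card I0"
proof -
  interpret S: prob_space S by (rule S)
  interpret product_prob_space M I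
    by (intro product_prob_space.intro product_sigma_finite.intro product_prob_space_axioms.intro)
      (auto intro: M prob_space_imp_sigma_finite)
  interpret R: prob_space "PiM (I - I0) M"
    by (intro prob_space_PiM M)
  interpret I0: prob_space "PiM I0 M"
    by (intro prob_space_PiM M)
  interpret SP: pair_prob_space S "PiM I M" ..
  have fin: "finite I0" "finite (I - I0)" and disj: "(I - I0) \<inter> I0 = {}" and un: "(I - I0) \<union> I0 = I"
    using I finite_subset by auto
  have inner: "emeasure (PiM I0 M) ((\<lambda>x. merge (I - I0) I0 (y, x)) -` (Pair z -` A) \<inter> space (PiM I0 M))
      \<le> ennreal (q ^ card I0)" (is "emeasure _ ?X \<le> _")
    for z y
  \<comment> \<open>The sets E are supplied only at points of A. A nonempty section provides such a
    point, and its E serves the whole section because all points of the section share z and the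
    coordinates y outside \<open>I0\<close>; the section then lies in a box.\<close>
  proof (cases "?X = {}")
    case False
    then obtain x where "(z, merge (I - I0) I0 (y, x)) \<in> A"
      by auto
    from miss[OF this] obtain E where E': "\<forall>i\<in>I0. E i \<in> sets (M i) \<and> measure (M i) (E i) \<le> q \<and>
        (\<forall>a'. (z, a') \<in> A \<longrightarrow> (\<forall>j\<in>I - I0. a' j = merge (I - I0) I0 (y, x) j) \<longrightarrow> a' i \<in> E i)"
      by (elim exE)
    then have E: "\<And>i. i \<in> I0 \<Longrightarrow> E i \<in> sets (M i)" "\<And>i. i \<in> I0 \<Longrightarrow> measure (M i) (E i) \<le> q"
      by auto
    have "?X \<subseteq> PiE I0 E"
    proof (intro subsetI PiE_I)
      fix x' i assume x': "x' \<in> ?X"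
      have "x' \<in> extensional I0"
        using x' by (simp add: space_PiM PiE_def)
      then show "x' i = undefined" if "i \<notin> I0"
        using that by (rule extensional_arb)
      assume i: "i \<in> I0"
      have "(z, merge (I - I0) I0 (y, x')) \<in> A"
        using x' by simp
      moreover have "\<forall>j\<in>I - I0. merge (I - I0) I0 (y, x') j = merge (I - I0) I0 (y, x) j"
        by (simp add: merge_def)
      ultimately have "merge (I - I0) I0 (y, x') i \<in> E i"
        using E' i by blast
      with i show "x' i \<in> E i"
        by (simp add: merge_def)
    qed
    then have "emeasure (PiM I0 M) ?X \<le> emeasure (PiM I0 M) (PiE I0 E)"
      using E fin by (intro emeasure_mono sets_PiM_I_finite) auto
    also have "\<dots> = (\<Prod>i\<in>I0. emeasure (M i) (E i))"
      using E fin by (intro emeasure_PiM) auto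
    also have "\<dots> \<le> (\<Prod>i\<in>I0. ennreal q)"
      using E by (intro prod_mono_ennreal) (auto simp: M.emeasure_eq_measure intro!: ennreal_leI)
    also have "\<dots> = ennreal (q ^ card I0)"
      using q by (simp add: ennreal_power)
    finally show ?thesis .
  qed simp
  have "emeasure (S \<Otimes>\<^sub>M PiM I M) A = (\<integral>\<^sup>+z. emeasure (PiM I M) (Pair z -` A) \<partial>S)"
    by (rule P.emeasure_pair_measure_alt[OF A])
  also have "\<dots> \<le> (\<integral>\<^sup>+z. ennreal (q ^ card I0) \<partial>S)"
  proof (rule nn_integral_mono)
    fix z
    have "Pair z -` A \<in> sets (PiM ((I - I0) \<union> I0) M)"
      using sets_Pair1[OF A] un by simp
    \<comment> \<open>Fubini for the second time: the coordinates outside \<open>I0\<close> are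
      integrated last, so the section bound holds while they are frozen.\<close>
    from emeasure_fold_integral[OF disj fin(2,1) this]
    have "emeasure (PiM I M) (Pair z -` A) =
        (\<integral>\<^sup>+y. emeasure (PiM I0 M) ((\<lambda>x. merge (I - I0) I0 (y, x)) -` (Pair z -` A) \<inter> space (PiM I0 M))
          \<partial>PiM (I - I0) M)"
      unfolding un .
    also have "\<dots> \<le> (\<integral>\<^sup>+y. ennreal (q ^ card I0) \<partial>PiM (I - I0) M)"
      by (intro nn_integral_mono inner)
    finally show "emeasure (PiM I M) (Pair z -` A) \<le> ennreal (q ^ card I0)"
      by (simp add: R.emeasure_space_1)
  qed
  finally show ?thesis
    using q by (simp add: S.emeasure_space_1 SP.P.emeasure_eq_measure)
qed

section \<open>Random finite sets and elementary estimates\<close>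

text \<open>The preimage of a single set is a finite intersection of events. Having the finite
  \<open>Pow K\<close> as target allows splitting a run space later according to the value of a
  random candidate set.\<close>

lemma measurable_finite_Collect_Pow:
  assumes K: "finite K" and P: "\<And>k. k \<in> K \<Longrightarrow> Measurable.pred M (\<lambda>\<omega>. Q \<omega> k)"
  shows "(\<lambda>\<omega>. {k\<in>K. Q \<omega> k}) \<in> M \<rightarrow>\<^sub>M count_space (Pow K)"
proof (subst measurable_count_space_eq2)
  have "{\<omega>\<in>space M. \<forall>k\<in>K. Q \<omega> k \<longleftrightarrow> k \<in> A} \<in> sets M" for A
    using K P by measurable
  moreover have "(\<lambda>\<omega>. {k\<in>K. Q \<omega> k}) -` {A} \<inter> space M = {\<omega>\<in>space M. \<forall>k\<in>K. Q \<omega> k \<longleftrightarrow> k \<in> A}"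
    if "A \<in> Pow K" for A
    using that by auto
  ultimately show "(\<lambda>\<omega>. {k\<in>K. Q \<omega> k}) \<in> space M \<rightarrow> Pow K \<and>
      (\<forall>A\<in>Pow K. (\<lambda>\<omega>. {k\<in>K. Q \<omega> k}) -` {A} \<inter> space M \<in> sets M)"
    by auto
qed (use K in simp)

lemma measurable_finite_Collect:
  assumes "finite K" "\<And>k. k \<in> K \<Longrightarrow> Measurable.pred M (\<lambda>\<omega>. Q \<omega> k)"
  shows "(\<lambda>\<omega>. {k\<in>K. Q \<omega> k}) \<in> M \<rightarrow>\<^sub>M count_space UNIV"
  using measurable_compose[OF measurable_finite_Collect_Pow[OF assms], where g="\<lambda>x. x"]
  by simp

lemma measurable_top_indices:
  assumes K: "finite K" and [measurable]: "\<And>k. k \<in> K \<Longrightarrow> (\<lambda>\<omega>. G \<omega> k) \<in> borel_measurable M"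
  shows "(\<lambda>\<omega>. top_indices p \<theta> s K (G \<omega>)) \<in> M \<rightarrow>\<^sub>M count_space UNIV"
  unfolding top_indices_def
proof (rule measurable_finite_Collect[OF K])
  fix k assume [measurable]: "k \<in> K"
  have "(\<lambda>\<omega>. {k'\<in>K. cmod (G \<omega> k) < cmod (G \<omega> k') \<or> cmod (G \<omega> k') = cmod (G \<omega> k) \<and> p k' < p k})
      \<in> M \<rightarrow>\<^sub>M count_space UNIV"
    by (rule measurable_finite_Collect[OF K]) measurable
  then have [measurable]: "Measurable.pred M (\<lambda>\<omega>. card {k'\<in>K. cmod (G \<omega> k) < cmod (G \<omega> k') \<or>
      cmod (G \<omega> k') = cmod (G \<omega> k) \<and> p k' < p k} < s)"
    by (rule measurable_compose[where g="\<lambda>X. card X < s"]) simp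
  show "Measurable.pred M (\<lambda>\<omega>. \<theta> \<le> cmod (G \<omega> k) \<and>
      card {k'\<in>K. cmod (G \<omega> k) < cmod (G \<omega> k') \<or> cmod (G \<omega> k') = cmod (G \<omega> k) \<and> p k' < p k} < s)"
    by measurable
qed

lemma pred_mem_count_space:
  "X \<in> M \<rightarrow>\<^sub>M count_space UNIV \<Longrightarrow> Measurable.pred M (\<lambda>\<omega>. k \<in> X \<omega>)"
  using measurable_compose[of X M "count_space UNIV" "\<lambda>A. k \<in> A" "count_space UNIV"] by simp

lemma top_indices_subset: "top_indices p \<theta> s K g \<subseteq> K"
  by (auto simp: top_indices_def)

lemma finite_draws: "finite (draws d P)"
proof -
  have "draws d P = (\<lambda>(t, i). ({t}, i)) ` ({1..d} \<times> {..<iterations P})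
      \<union> (\<Union>t\<in>{2..d}. Pair {1..t} ` {..<iters2 d P t})"
    by (auto simp: draws_def)
  then show ?thesis
    by simp
qed

lemma draws_single: "t \<in> {1..d} \<Longrightarrow> i < iterations P \<Longrightarrow> ({t}, i) \<in> draws d P"
  and draws_prefix: "t \<in> {2..d} \<Longrightarrow> i < iters2 d P t \<Longrightarrow> ({1..t}, i) \<in> draws d P"
  by (auto simp: draws_def)

lemma prefix_set_rec:
  "2 \<le> t \<Longrightarrow> prefix_set d \<phi> f P t \<omega> =
     (if constr_ok d \<phi> f P t \<omega> then \<Union>i<iters2 d P t. detect2 d \<phi> f P t (cand2 d \<phi> f P t \<omega>) i \<omega> else {})"
  by (cases "(d, \<phi>, f, P, t, \<omega>)" rule: prefix_set.cases)
    (auto simp: Let_def constr_ok_def cand2_def used_rule2_def)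

lemma cand2_subset: "cand2 d \<phi> f P t \<omega> \<subseteq> proj {1..t} (search P)"
  by (auto simp: cand2_def candidates_def)

lemma restrict_proj: "k \<in> proj u J \<Longrightarrow> w \<subseteq> u \<Longrightarrow> restrict k w \<in> proj w J"
  by (auto simp: proj_def inf.absorb2)

lemma proj_mono: "J \<subseteq> H \<Longrightarrow> proj u J \<subseteq> proj u H"
  by (auto simp: proj_def)

lemma card_proj_le: "finite J \<Longrightarrow> card (proj u J) \<le> card J"
  unfolding proj_def by (rule card_image_le)

text \<open>From 1 - x \<le> exp (- x) with x = 2 / (3 B^2 N): the summand 3/2 B^2 N in the bound on
  r is 1 / x, so r x is at least the logarithmic factor L, and exp (- L) = \<epsilon> / (3 D N).
  This is the share of one pair of coordinate set and index in a budget of \<epsilon> / 3 for D N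
  pairs.\<close>

lemma miss_power_le:
  fixes B N D X \<epsilon> :: real
  assumes B: "1 \<le> B" and N: "1 \<le> N" and D: "1 \<le> D" and X: "0 \<le> X" and \<epsilon>: "0 < \<epsilon>" "\<epsilon> < 1"
    and r: "real r \<ge> (1 + 3 / 2 * B\<^sup>2 * N + X) * (ln 3 + ln D + ln N - ln \<epsilon>)"
  shows "0 \<le> 1 - 2 / (3 * B\<^sup>2 * N)" "(1 - 2 / (3 * B\<^sup>2 * N)) ^ r \<le> \<epsilon> / (3 * D * N)"
proof -
  define b where "b = B\<^sup>2 * N"
  have "1 * 1 \<le> B\<^sup>2 * N"
    using B N by (intro mult_mono) auto
  then have b: "1 \<le> b"
    by (simp add: b_def)
  have bN: "3 * B\<^sup>2 * N = 3 * b"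
    by (simp add: b_def)
  show q: "0 \<le> 1 - 2 / (3 * B\<^sup>2 * N)"
    unfolding bN using b by (simp add: field_simps)
  define L where "L = ln 3 + ln D + ln N - ln \<epsilon>"
  have "ln \<epsilon> \<le> 0"
    using \<epsilon> by simp
  moreover have "0 \<le> ln (3::real)" "0 \<le> ln D" "0 \<le> ln N"
    using D N by auto
  ultimately have L: "0 \<le> L"
    unfolding L_def by linarith
  have "(1 + 3 / 2 * b + X) * L \<ge> 3 / 2 * b * L"
    using L X by (intro mult_right_mono) auto
  with r have "3 / 2 * b * L \<le> real r"
    unfolding L_def [symmetric] by (simp add: b_def mult.assoc)
  then have Lr: "L \<le> real r * (2 / (3 * b))"
    using b by (simp add: field_simps)
  have "(1 - 2 / (3 * b)) ^ r \<le> exp (- (2 / (3 * b))) ^ r"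
    using q exp_ge_add_one_self[of "- (2 / (3 * b))"] unfolding bN by (intro power_mono) auto
  also have "\<dots> = exp (- (real r * (2 / (3 * b))))"
    by (simp flip: exp_of_nat_mult)
  also have "\<dots> \<le> exp (- L)"
    using Lr by simp
  also have "\<dots> = \<epsilon> / (3 * D * N)"
    using D N \<epsilon> by (simp add: L_def exp_diff exp_add exp_minus field_simps)
  finally show "(1 - 2 / (3 * B\<^sup>2 * N)) ^ r \<le> \<epsilon> / (3 * D * N)"
    unfolding bN .
qed

section \<open>Measurability of the sets found in a run\<close>

locale dia_run = product_expansion +
  fixes S :: "'z measure" and P :: "'z dia_params"
  assumes seed: "prob_space S" and params: "valid_params d \<mu> \<phi> S P"
begin

abbreviation "R \<equiv> run_space d \<mu> S P"
abbreviation "detected1 \<equiv> single_set d \<phi> f P"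
abbreviation "detected \<equiv> prefix_set d \<phi> f P"
abbreviation "cand \<equiv> cand2 d \<phi> f P"
abbreviation "pcoeff \<equiv> proj_coeff d \<phi> f"

lemma finite_proj_search: "finite (proj u (search P))"
  using params by (simp add: valid_params_def proj_def)

lemma rule1_space: "t \<in> {1..d} \<Longrightarrow> rule1 P t \<in> space (cubature_space \<mu> {t})"
  and rule1_exact: "t \<in> {1..d} \<Longrightarrow> cub_exact \<phi> {t} (proj {t} (search P)) (rule1 P t)"
  and rule2_measurable: "t \<in> {2..d} \<Longrightarrow> K \<subseteq> proj {1..t} (search P) \<Longrightarrow>
     rule2 P t K \<in> S \<rightarrow>\<^sub>M cubature_space \<mu> {1..t}"
  using params by (auto simp: valid_params_def)

lemma prob_space_draws: "prob_space (PiM (draws d P) (\<lambda>(u, i). PiM ({1..d} - u) \<mu>))"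
  by (intro prob_space_PiM) (auto intro!: prob_space_prod)

lemma prob_space_run: "prob_space R"
  unfolding run_space_def by (intro prob_space_pair seed prob_space_draws)

lemma fst_measurable: "fst \<in> R \<rightarrow>\<^sub>M S"
  unfolding run_space_def by measurable

lemma anchor_measurable:
  assumes "(u, i) \<in> draws d P"
  shows "(\<lambda>\<omega>. snd \<omega> (u, i)) \<in> R \<rightarrow>\<^sub>M PiM ({1..d} - u) \<mu>"
  unfolding run_space_def
  using measurable_compose[OF measurable_snd measurable_component_singleton[OF assms, of "\<lambda>(u, i). PiM ({1..d} - u) \<mu>"]]
  by simp

lemma coeff_run_measurable:
  assumes u: "u \<subseteq> {1..d}" and Q: "Q \<in> R \<rightarrow>\<^sub>M cubature_space \<mu> u" and i: "(u, i) \<in> draws d P"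
  shows "(\<lambda>\<omega>. pcoeff u (Q \<omega>) (snd \<omega> (u, i)) k) \<in> borel_measurable R"
  using measurable_compose[OF measurable_Pair[OF Q anchor_measurable[OF i]] proj_coeff_measurable[OF u, of k]]
  by simp

lemma coeff_single_measurable:
  "t \<in> {1..d} \<Longrightarrow> i < iterations P \<Longrightarrow>
     (\<lambda>\<omega>. pcoeff {t} (rule1 P t) (snd \<omega> ({t}, i)) k) \<in> borel_measurable R"
  by (intro coeff_run_measurable measurable_const rule1_space draws_single) auto

lemma coeff_prefix_measurable:
  "t \<in> {2..d} \<Longrightarrow> i < iters2 d P t \<Longrightarrow> K \<subseteq> proj {1..t} (search P) \<Longrightarrow>
     (\<lambda>\<omega>. pcoeff {1..t} (rule2 P t K (fst \<omega>)) (snd \<omega> ({1..t}, i)) k) \<in> borel_measurable R"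
  by (intro coeff_run_measurable measurable_compose[OF fst_measurable rule2_measurable] draws_prefix) auto

lemma single_subset: "detected1 t \<omega> \<subseteq> proj {t} (search P)"
  using top_indices_subset by (force simp: single_set_def detect1_def)

lemma single_measurable:
  assumes t: "t \<in> {1..d}"
  shows "detected1 t \<in> R \<rightarrow>\<^sub>M count_space UNIV"
proof -
  have "(\<lambda>\<omega>. detect1 d \<phi> f P t i \<omega>) \<in> R \<rightarrow>\<^sub>M count_space UNIV" if "i < iterations P" for i
    unfolding detect1_def
    by (intro measurable_top_indices finite_proj_search coeff_single_measurable t that)
  note [measurable] = pred_mem_count_space[OF this]
  have "detected1 t = (\<lambda>\<omega>. {k\<in>proj {t} (search P). \<exists>i\<in>{..<iterations P}. k \<in> detect1 d \<phi> f P t i \<omega>})"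
    using single_subset by (fastforce simp: single_set_def)
  also have "\<dots> \<in> R \<rightarrow>\<^sub>M count_space UNIV"
    by (intro measurable_finite_Collect finite_proj_search) (measurable; simp)
  finally show ?thesis .
qed

lemma exact_measurable:
  assumes t: "t \<in> {2..d}" and K: "K \<subseteq> proj {1..t} (search P)"
  shows "Measurable.pred R (\<lambda>\<omega>. cub_exact \<phi> {1..t} K (rule2 P t K (fst \<omega>)))"
proof -
  have [measurable]: "finite K"
    using K finite_proj_search finite_subset by blast
  have "(\<lambda>\<omega>. cub_pair \<phi> {1..t} (rule2 P t K (fst \<omega>)) h k) \<in> borel_measurable R" for h k
    using t by (intro measurable_compose[OF _ cub_pair_measurable]
      measurable_compose[OF fst_measurable rule2_measurable[OF t K]]) auto
  note [measurable] = this
  show ?thesis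
    unfolding cub_exact_def by measurable
qed

lemma cand_measurable_prefix:
  assumes t: "t \<in> {2..d}" and "detected (t - 1) \<in> R \<rightarrow>\<^sub>M count_space UNIV"
  shows "cand t \<in> R \<rightarrow>\<^sub>M count_space (Pow (proj {1..t} (search P)))"
proof -
  have "t \<in> {1..d}"
    using t by simp
  note [measurable] = pred_mem_count_space[OF single_measurable[OF this]] pred_mem_count_space[OF assms(2)]
  have "(\<lambda>\<omega>. {k\<in>proj {1..t} (search P). restrict k {1..t - 1} \<in> detected (t - 1) \<omega> \<and> restrict k {t} \<in> detected1 t \<omega>})
      \<in> R \<rightarrow>\<^sub>M count_space (Pow (proj {1..t} (search P)))"
    by (intro measurable_finite_Collect_Pow finite_proj_search) measurable
  then show ?thesis
    by (simp add: cand2_def [abs_def] candidates_def)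
qed

text \<open>\<open>rule2 P t K\<close> is measurable in the seed for each fixed K, but the algorithm
  inserts the random set \<open>cand t \<omega>\<close> for K. That set takes finitely many values,
  so measurability is shown for each K and the pieces are glued. Together with
  \<open>cand_measurable_prefix\<close> this is the induction step of
  \<open>prefix_measurable\<close>.\<close>

lemma prefix_measurable_aux:
  assumes t: "t \<in> {2..d}" and cand: "cand t \<in> R \<rightarrow>\<^sub>M count_space (Pow (proj {1..t} (search P)))"
  shows "detected t \<in> R \<rightarrow>\<^sub>M count_space UNIV"
proof -
  define g where "g K \<omega> = {k\<in>K. cub_exact \<phi> {1..t} K (rule2 P t K (fst \<omega>)) \<and>
      (\<exists>i\<in>{..<iters2 d P t}. k \<in> detect2 d \<phi> f P t K i \<omega>)}" for K \<omega>
  have "g K \<in> R \<rightarrow>\<^sub>M count_space UNIV" if "K \<in> Pow (proj {1..t} (search P))" for K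
  proof -
    have fin: "finite K" and K: "K \<subseteq> proj {1..t} (search P)"
      using that finite_proj_search finite_subset by blast+
    have "(\<lambda>\<omega>. detect2 d \<phi> f P t K i \<omega>) \<in> R \<rightarrow>\<^sub>M count_space UNIV" if "i < iters2 d P t" for i
      unfolding detect2_def by (intro measurable_top_indices fin coeff_prefix_measurable t that K)
    note [measurable] = pred_mem_count_space[OF this] exact_measurable[OF t K]
    show ?thesis
      unfolding g_def by (intro measurable_finite_Collect fin) (measurable; simp)
  qed
  then have "(\<lambda>\<omega>. g (cand t \<omega>) \<omega>) \<in> R \<rightarrow>\<^sub>M count_space UNIV"
    by (rule measurable_compose_countable'[where f=g, OF _ cand])
      (simp_all add: finite_proj_search countable_finite)
  moreover have "detected t = (\<lambda>\<omega>. g (cand t \<omega>) \<omega>)"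
  proof
    fix \<omega>
    have "detect2 d \<phi> f P t (cand t \<omega>) i \<omega> \<subseteq> cand t \<omega>" for i
      by (simp add: detect2_def top_indices_subset)
    moreover have "2 \<le> t"
      using t by simp
    ultimately show "detected t \<omega> = g (cand t \<omega>) \<omega>"
      unfolding g_def prefix_set_rec[OF \<open>2 \<le> t\<close>] constr_ok_def used_rule2_def by (intro set_eqI) (simp, blast)
  qed
  ultimately show ?thesis
    by simp
qed

lemma prefix_measurable: "1 \<le> t \<Longrightarrow> t \<le> d \<Longrightarrow> detected t \<in> R \<rightarrow>\<^sub>M count_space UNIV"
proof (induction t rule: nat_induct_at_least)
  case base
  have "detected 1 = detected1 1"
    by (simp add: fun_eq_iff)
  then show ?case
    using single_measurable[of 1] base by simp
next
  case (Suc t)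
  show ?case
    by (rule prefix_measurable_aux[OF _ cand_measurable_prefix]) (use Suc in simp_all)
qed

lemma cand_measurable:
  "t \<in> {2..d} \<Longrightarrow> cand t \<in> R \<rightarrow>\<^sub>M count_space (Pow (proj {1..t} (search P)))"
  by (intro cand_measurable_prefix prefix_measurable) auto

lemma pred_cand_compose:
  assumes t: "t \<in> {2..d}"
    and "\<And>K. K \<subseteq> proj {1..t} (search P) \<Longrightarrow> Measurable.pred R (g K)"
  shows "Measurable.pred R (\<lambda>\<omega>. g (cand t \<omega>) \<omega>)"
  by (rule measurable_compose_countable'[where f=g, OF _ cand_measurable[OF t]])
    (use assms(2) finite_proj_search in \<open>simp_all add: countable_finite\<close>)

lemma constr_ok_measurable: "t \<in> {2..d} \<Longrightarrow> Measurable.pred R (constr_ok d \<phi> f P t)"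
  using pred_cand_compose[OF _ exact_measurable, of t]
  by (simp add: constr_ok_def [abs_def] used_rule2_def)

section \<open>Dependence on the draws and bounds for the miss events\<close>

text \<open>The anchors for \<open>{1..t}\<close> are read only in the detection for
  \<open>{1..t}\<close> itself, so changing them leaves all single-coordinate sets and all shorter
  prefixes untouched. The seed z is the same on both sides, since it may influence every
  construction.\<close>

lemma
  assumes eq: "\<And>j. j \<in> draws d P \<Longrightarrow> fst j \<noteq> {1..t} \<Longrightarrow> a j = b j" and t: "2 \<le> t" "t \<le> d"
  shows single_set_local: "s \<in> {1..d} \<Longrightarrow> detected1 s (z, a) = detected1 s (z, b)"
    and prefix_set_local: "1 \<le> n \<Longrightarrow> n < t \<Longrightarrow> detected n (z, a) = detected n (z, b)"
proof -
  \<comment> \<open>Here t \<ge> 2 matters: draws are labelled by coordinate sets, and for t = 1 the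
    single-coordinate and prefix labels would coincide.\<close>
  have ne: "{s} \<noteq> {1..t}" for s :: nat
  proof
    assume "{s} = {1..t}"
    from arg_cong[OF this, of card] t show False
      by simp
  qed
  show single: "detected1 s (z, a) = detected1 s (z, b)" if "s \<in> {1..d}" for s
  proof -
    have "a ({s}, i) = b ({s}, i)" if "i < iterations P" for i
      by (intro eq draws_single \<open>s \<in> {1..d}\<close> that) (use ne in simp)
    then show ?thesis
      by (simp add: single_set_def detect1_def)
  qed
  show "detected n (z, a) = detected n (z, b)" if "1 \<le> n" "n < t" for n
    using that
  proof (induction n rule: nat_induct_at_least)
    case base
    then show ?case
      using single[of 1] t by simp
  next
    case (Suc n)
    have n: "Suc n \<in> {2..d}" "Suc n \<in> {1..d}"
      using Suc t by auto
    have cand: "cand (Suc n) (z, a) = cand (Suc n) (z, b)"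
      using Suc single[OF n(2)] by (simp add: cand2_def)
    have "{1..Suc n} \<noteq> {1..t}"
      using arg_cong[of "{1..Suc n}" "{1..t}" card] Suc by auto
    then have "detect2 d \<phi> f P (Suc n) K i (z, a) = detect2 d \<phi> f P (Suc n) K i (z, b)"
      if "i < iters2 d P (Suc n)" for K i
      using eq[OF draws_prefix[OF n(1) that]] by (simp add: detect2_def)
    then show ?case
      using n cand by (subst (1 2) prefix_set_rec) (auto simp: constr_ok_def used_rule2_def)
  qed
qed

lemma cand_local:
  assumes "\<And>j. j \<in> draws d P \<Longrightarrow> fst j \<noteq> {1..t} \<Longrightarrow> a j = b j" and "t \<in> {2..d}"
  shows "cand t (z, a) = cand t (z, b)"
proof -
  have "detected1 t (z, a) = detected1 t (z, b)"
    by (rule single_set_local[where t=t, OF assms(1)]) (use assms(2) in simp_all)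
  moreover have "detected (t - 1) (z, a) = detected (t - 1) (z, b)"
    by (rule prefix_set_local[where t=t, OF assms(1)]) (use assms(2) in auto)
  ultimately show ?thesis
    by (simp add: cand2_def)
qed

definition miss1 where
  "miss1 t k = {\<omega>\<in>space R. \<forall>i<iterations P.
     cmod (pcoeff {t} (rule1 P t) (snd \<omega> ({t}, i)) k) < threshold P}"

text \<open>With success of the construction and completeness of the candidates included in the
  event, the one-anchor bound is available at each of its elements, without any conditional
  probability.\<close>

definition miss2 where
  "miss2 J t k = {\<omega>\<in>space R. constr_ok d \<phi> f P t \<omega> \<and> proj {1..t} J \<subseteq> cand t \<omega> \<and>
     (\<forall>i<iterations P. cmod (pcoeff {1..t} (used_rule2 d \<phi> f P t \<omega>) (snd \<omega> ({1..t}, i)) k) < threshold P)}"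

lemma miss1_sets: "t \<in> {1..d} \<Longrightarrow> miss1 t k \<in> sets R"
proof -
  assume t: "t \<in> {1..d}"
  have *: "Measurable.pred R (\<lambda>\<omega>. cmod (pcoeff {t} (rule1 P t) (snd \<omega> ({t}, i)) k) < threshold P)"
    if "i < iterations P" for i
    by (rule borel_measurable_pred_less[OF measurable_compose[OF coeff_single_measurable[OF t that]
        borel_measurable_norm] borel_measurable_const])
  have "Measurable.pred R (\<lambda>\<omega>. \<forall>i\<in>{..<iterations P}.
      cmod (pcoeff {t} (rule1 P t) (snd \<omega> ({t}, i)) k) < threshold P)"
    by (rule pred_intros_finite(3)[OF finite_lessThan]) (rule *, simp)
  from predE[OF this] show ?thesis
    unfolding miss1_def by (simp only: Ball_def lessThan_iff)
qed

lemma miss2_sets: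
  assumes "t \<in> {2..<d}"
  shows "miss2 J t k \<in> sets R"
proof -
  have t: "t \<in> {2..d}" and it: "iters2 d P t = iterations P"
    using assms by (auto simp: iters2_def)
  define g where "g K \<omega> \<longleftrightarrow> cub_exact \<phi> {1..t} K (rule2 P t K (fst \<omega>)) \<and> proj {1..t} J \<subseteq> K \<and>
    (\<forall>i\<in>{..<iterations P}. cmod (pcoeff {1..t} (rule2 P t K (fst \<omega>)) (snd \<omega> ({1..t}, i)) k) < threshold P)"
    for K \<omega>
  have "Measurable.pred R (\<lambda>\<omega>. g (cand t \<omega>) \<omega>)"
  proof (rule pred_cand_compose[OF t])
    fix K assume K: "K \<subseteq> proj {1..t} (search P)"
    note [measurable] = exact_measurable[OF t K]
    have *: "Measurable.pred R (\<lambda>\<omega>. cmod (pcoeff {1..t} (rule2 P t K (fst \<omega>)) (snd \<omega> ({1..t}, i)) k)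
        < threshold P)" if "i < iterations P" for i
      by (rule borel_measurable_pred_less[OF measurable_compose[OF
          coeff_prefix_measurable[OF t _ K, unfolded it, OF that] borel_measurable_norm] borel_measurable_const])
    have [measurable]: "Measurable.pred R (\<lambda>\<omega>. \<forall>i\<in>{..<iterations P}.
      cmod (pcoeff {1..t} (rule2 P t K (fst \<omega>)) (snd \<omega> ({1..t}, i)) k) < threshold P)"
      by (rule pred_intros_finite(3)[OF finite_lessThan]) (rule *, simp)
    show "Measurable.pred R (g K)"
      unfolding g_def by measurable
  qed
  from predE[OF this] show ?thesis
    unfolding miss2_def g_def constr_ok_def used_rule2_def by (simp only: Ball_def lessThan_iff)
qed

text \<open>The rule of Step 1 is not random, so one and the same set of bad anchors serves for all
  seeds and all iterations.\<close>

lemma measure_miss1_le: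
  assumes t: "t \<in> {1..d}" and q: "0 \<le> q"
    and bound: "measure (PiM ({1..d} - {t}) \<mu>)
      {x\<in>space (PiM ({1..d} - {t}) \<mu>). cmod (pcoeff {t} (rule1 P t) x k) < threshold P} \<le> q"
  shows "measure R (miss1 t k) \<le> q ^ iterations P"
proof -
  define I0 where "I0 = Pair {t} ` {..<iterations P}"
  let ?E = "{x\<in>space (PiM ({1..d} - {t}) \<mu>). cmod (pcoeff {t} (rule1 P t) x k) < threshold P}"
  have u: "{t} \<subseteq> {1..d}"
    using t by simp
  have "(\<lambda>x. pcoeff {t} (rule1 P t) x k) \<in> borel_measurable (PiM ({1..d} - {t}) \<mu>)"
    using measurable_compose[OF measurable_Pair[OF measurable_const[OF rule1_space[OF t]] measurable_ident]
        proj_coeff_measurable[OF u, of k]] by (simp add: id_def)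
  then have E: "?E \<in> sets (PiM ({1..d} - {t}) \<mu>)"
    by measurable
  have "measure R (miss1 t k) \<le> q ^ card I0"
    unfolding run_space_def
  proof (rule iterated_miss_le[OF seed finite_draws _ _ _ q])
    show "I0 \<subseteq> draws d P"
      unfolding I0_def using draws_single[OF t] by auto
    show "prob_space (case j of (u, i) \<Rightarrow> PiM ({1..d} - u) \<mu>)" for j
      by (auto split: prod.split intro!: prob_space_prod)
    show "miss1 t k \<in> sets (S \<Otimes>\<^sub>M PiM (draws d P) (\<lambda>(u, i). PiM ({1..d} - u) \<mu>))"
      using miss1_sets[OF t, of k] by (simp add: run_space_def)
    fix z a
    have mem: "a' ({t}, i) \<in> ?E" if "(z, a') \<in> miss1 t k" "i < iterations P" for a' i
      using that measurable_space[OF anchor_measurable[OF draws_single[OF t that(2)]], of "(z, a')"]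
      by (auto simp: miss1_def)
    show "\<exists>E. \<forall>j\<in>I0. E j \<in> sets (case j of (u, i) \<Rightarrow> PiM ({1..d} - u) \<mu>) \<and>
        measure (case j of (u, i) \<Rightarrow> PiM ({1..d} - u) \<mu>) (E j) \<le> q \<and>
        (\<forall>a'. (z, a') \<in> miss1 t k \<longrightarrow> (\<forall>j\<in>draws d P - I0. a' j = a j) \<longrightarrow> a' j \<in> E j)"
    proof (intro exI[of _ "\<lambda>_. ?E"] ballI)
      fix j assume "j \<in> I0"
      then obtain i where i: "i < iterations P" and j: "j = ({t}, i)"
        by (auto simp: I0_def)
      show "?E \<in> sets (case j of (u, i) \<Rightarrow> PiM ({1..d} - u) \<mu>) \<and>
          measure (case j of (u, i) \<Rightarrow> PiM ({1..d} - u) \<mu>) ?E \<le> q \<and>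
          (\<forall>a'. (z, a') \<in> miss1 t k \<longrightarrow> (\<forall>j\<in>draws d P - I0. a' j = a j) \<longrightarrow> a' j \<in> ?E)"
        unfolding j prod.case using E bound mem[OF _ i] by (intro conjI allI impI)
    qed
  qed
  moreover have "card I0 = iterations P"
    unfolding I0_def by (subst card_image) (auto intro: inj_onI)
  ultimately show ?thesis
    by simp
qed

text \<open>Once the seed and the anchors of all other coordinate sets are frozen, the candidate set
  is fixed, hence so are the rule and the set E of bad anchors. A miss requires each of the r
  remaining independent anchors to fall into E.\<close>

lemma measure_miss2_le:
  assumes t: "t \<in> {2..<d}" and q: "0 \<le> q"
    and bound: "\<And>\<omega>. \<omega> \<in> miss2 J t k \<Longrightarrow> measure (PiM ({1..d} - {1..t}) \<mu>)
      {x\<in>space (PiM ({1..d} - {1..t}) \<mu>). cmod (pcoeff {1..t} (used_rule2 d \<phi> f P t \<omega>) x k) < threshold P} \<le> q"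
  shows "measure R (miss2 J t k) \<le> q ^ iterations P"
proof -
  have t': "t \<in> {2..d}" and it: "iters2 d P t = iterations P"
    using t by (auto simp: iters2_def)
  define I0 where "I0 = Pair {1..t} ` {..<iterations P}"
  have u: "{1..t} \<subseteq> {1..d}"
    using t by auto
  have "measure R (miss2 J t k) \<le> q ^ card I0"
    unfolding run_space_def
  proof (rule iterated_miss_le[OF seed finite_draws _ _ _ q])
    show "I0 \<subseteq> draws d P"
      unfolding I0_def by (intro image_subsetI draws_prefix[OF t']) (simp add: it)
    show "prob_space (case j of (u, i) \<Rightarrow> PiM ({1..d} - u) \<mu>)" for j
      by (auto split: prod.split intro!: prob_space_prod)
    show "miss2 J t k \<in> sets (S \<Otimes>\<^sub>M PiM (draws d P) (\<lambda>(u, i). PiM ({1..d} - u) \<mu>))"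
      using miss2_sets[OF t, of J k] by (simp add: run_space_def)
    fix z a assume za: "(z, a) \<in> miss2 J t k"
    then have "z \<in> space S"
      by (simp add: miss2_def run_space_def space_pair_measure)
    define Q where "Q = rule2 P t (cand t (z, a)) z"
    have Q: "Q \<in> space (cubature_space \<mu> {1..t})"
      unfolding Q_def using measurable_space[OF rule2_measurable[OF t' cand2_subset] \<open>z \<in> space S\<close>] .
    define E where "E = {x\<in>space (PiM ({1..d} - {1..t}) \<mu>). cmod (pcoeff {1..t} Q x k) < threshold P}"
    have "(\<lambda>x. pcoeff {1..t} Q x k) \<in> borel_measurable (PiM ({1..d} - {1..t}) \<mu>)"
      using measurable_compose[OF measurable_Pair[OF measurable_const[OF Q] measurable_ident]
          proj_coeff_measurable[OF u, of k]] by (simp add: id_def)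
    then have E: "E \<in> sets (PiM ({1..d} - {1..t}) \<mu>)"
      unfolding E_def by measurable
    have E_le: "measure (PiM ({1..d} - {1..t}) \<mu>) E \<le> q"
      using bound[OF za] by (simp add: E_def Q_def used_rule2_def)
    have mem: "a' ({1..t}, i) \<in> E"
      if "(z, a') \<in> miss2 J t k" "\<forall>j\<in>draws d P - I0. a' j = a j" "i < iterations P" for a' i
    proof -
      \<comment> \<open>The two runs may differ only in \<open>I0\<close>, whose labels all have
        first component \<open>{1..t}\<close>; this is exactly what \<open>cand_local\<close>
        permits.\<close>
      have "cand t (z, a') = cand t (z, a)"
      proof (rule cand_local[OF _ t'])
        fix j assume "j \<in> draws d P" "fst j \<noteq> {1..t}"
        then have "j \<in> draws d P - I0"
          unfolding I0_def by force
        with that(2) show "a' j = a j"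
          by blast
      qed
      then have "used_rule2 d \<phi> f P t (z, a') = Q"
        by (simp add: used_rule2_def Q_def)
      moreover have "a' ({1..t}, i) \<in> space (PiM ({1..d} - {1..t}) \<mu>)"
      proof -
        have "({1..t}, i) \<in> draws d P"
          using that(3) by (intro draws_prefix[OF t']) (simp add: it)
        moreover have "(z, a') \<in> space R"
          using that(1) unfolding miss2_def by blast
        ultimately show ?thesis
          using measurable_space[OF anchor_measurable, of "{1..t}" i "(z, a')"] by (simp only: snd_conv)
      qed
      ultimately show ?thesis
        using that(1,3) by (simp add: miss2_def E_def)
    qed
    show "\<exists>E. \<forall>j\<in>I0. E j \<in> sets (case j of (u, i) \<Rightarrow> PiM ({1..d} - u) \<mu>) \<and>
        measure (case j of (u, i) \<Rightarrow> PiM ({1..d} - u) \<mu>) (E j) \<le> q \<and>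
        (\<forall>a'. (z, a') \<in> miss2 J t k \<longrightarrow> (\<forall>j\<in>draws d P - I0. a' j = a j) \<longrightarrow> a' j \<in> E j)"
    proof (intro exI[of _ "\<lambda>_. E"] ballI)
      fix j assume "j \<in> I0"
      then obtain i where i: "i < iterations P" and j: "j = ({1..t}, i)"
        by (auto simp: I0_def)
      show "E \<in> sets (case j of (u, i) \<Rightarrow> PiM ({1..d} - u) \<mu>) \<and>
          measure (case j of (u, i) \<Rightarrow> PiM ({1..d} - u) \<mu>) E \<le> q \<and>
          (\<forall>a'. (z, a') \<in> miss2 J t k \<longrightarrow> (\<forall>j\<in>draws d P - I0. a' j = a j) \<longrightarrow> a' j \<in> E)"
        unfolding j prod.case using E E_le mem[OF _ _ i] by (intro conjI allI impI)
    qed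
  qed
  moreover have "card I0 = iterations P"
    unfolding I0_def by (subst card_image) (auto intro: inj_onI)
  ultimately show ?thesis
    by simp
qed

section \<open>Runs without bad events and the union bound\<close>

lemma used_rule2_space:
  assumes "\<omega> \<in> space R" "t \<in> {2..d}"
  shows "used_rule2 d \<phi> f P t \<omega> \<in> space (cubature_space \<mu> {1..t})"
  unfolding used_rule2_def
  using measurable_space[OF rule2_measurable[OF assms(2) cand2_subset] measurable_space[OF fst_measurable assms(1)]] .

text \<open>The deterministic half of the argument, by induction on t. Both parts of an index of
  \<open>proj {1..t} J\<close> have been detected before, so it is a candidate; a hit together with
  the harmless cut-off then keeps it. For d = 1 the base case already is the output.\<close>

lemma output_complete:
  assumes \<omega>: "\<omega> \<in> space R" and J: "J \<subseteq> mindex {1..d}" "J \<subseteq> search P"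
    and harmless: "cutoff_harmless d \<mu> \<phi> f S P J"
    and hit1: "\<And>t k. t \<in> {1..d} \<Longrightarrow> k \<in> proj {t} J \<Longrightarrow> \<omega> \<notin> miss1 t k"
    and hit2: "\<And>t k. t \<in> {2..<d} \<Longrightarrow> k \<in> proj {1..t} J \<Longrightarrow> \<omega> \<notin> miss2 J t k"
    and ok: "\<And>t. t \<in> {2..d} \<Longrightarrow> constr_ok d \<phi> f P t \<omega>"
    and last: "\<And>k. 2 \<le> d \<Longrightarrow> proj {1..d} J \<subseteq> cand d \<omega> \<Longrightarrow> k \<in> proj {1..d} J \<Longrightarrow>
      threshold P \<le> cmod (pcoeff {1..d} (used_rule2 d \<phi> f P d \<omega>) (snd \<omega> ({1..d}, 0)) k)"
  shows "J \<subseteq> output_set d \<phi> f P \<omega>"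
proof -
  have single: "proj {t} J \<subseteq> detected1 t \<omega>" if t: "t \<in> {1..d}" for t
  proof
    fix k assume k: "k \<in> proj {t} J"
    from hit1[OF t k] \<omega> obtain i where i: "i < iterations P"
      "threshold P \<le> cmod (pcoeff {t} (rule1 P t) (snd \<omega> ({t}, i)) k)"
      by (auto simp: miss1_def not_less)
    with harmless \<omega> t k have "k \<in> detect1 d \<phi> f P t i \<omega>"
      unfolding cutoff_harmless_def by blast
    with i show "k \<in> detected1 t \<omega>"
      by (auto simp: single_set_def)
  qed
  have "proj {1..t} J \<subseteq> detected t \<omega>" if "1 \<le> t" "t \<le> d" for t
    using that
  proof (induction t rule: nat_induct_at_least)
    case base
    then show ?case
      using single[of 1] by simp
  next
    case (Suc n)
    let ?t = "Suc n"
    have t: "?t \<in> {2..d}" "?t \<in> {1..d}" "2 \<le> ?t"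
      using Suc by auto
    have cand: "proj {1..?t} J \<subseteq> cand ?t \<omega>"
    proof
      fix k assume k: "k \<in> proj {1..?t} J"
      have "restrict k {1..n} \<in> proj {1..n} J" "restrict k {?t} \<in> proj {?t} J"
        using k by (intro restrict_proj[OF k]; simp)+
      moreover have "k \<in> proj {1..?t} (search P)"
        using k proj_mono[OF J(2)] by blast
      ultimately show "k \<in> cand ?t \<omega>"
        using Suc single[OF t(2)] by (auto simp: cand2_def candidates_def)
    qed
    show ?case
    proof
      fix k assume k: "k \<in> proj {1..?t} J"
      \<comment> \<open>Below d, avoiding \<open>miss2\<close> yields a successful iteration,
        because its two side conditions hold here. At d the only iteration is number 0 and
        \<open>last\<close> supplies the hit.\<close>
      obtain i where i: "i < iters2 d P ?t"
        "threshold P \<le> cmod (pcoeff {1..?t} (used_rule2 d \<phi> f P ?t \<omega>) (snd \<omega> ({1..?t}, i)) k)"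
      proof (cases "?t < d")
        case True
        then have "\<omega> \<notin> miss2 J ?t k"
          using t k by (intro hit2) auto
        with \<omega> ok[OF t(1)] cand True that show ?thesis
          by (auto simp: miss2_def iters2_def not_less)
      next
        case False
        then have "?t = d"
          using Suc by simp
        with last t cand k that[of 0] show ?thesis
          by (simp add: iters2_def)
      qed
      with harmless \<omega> t(1) ok[OF t(1)] k cand
      have "k \<in> detect2 d \<phi> f P ?t (cand ?t \<omega>) i \<omega>"
        unfolding cutoff_harmless_def by blast
      with i(1) ok[OF t(1)] show "k \<in> detected ?t \<omega>"
        unfolding prefix_set_rec[OF t(3)] by auto
    qed
  qed
  from this[of d] d_pos have "proj {1..d} J \<subseteq> output_set d \<phi> f P \<omega>"
    by (simp add: output_set_def)
  moreover have "proj {1..d} J = J"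
  proof -
    have "restrict h {1..d} = h" if "h \<in> J" for h
      using that J(1) by (intro PiE_restrict[of h _ "\<lambda>_. UNIV"]) (auto simp: mindex_def)
    then show ?thesis
      by (auto simp: proj_def)
  qed
  ultimately show ?thesis
    by simp
qed

lemma output_measurable: "{\<omega>\<in>space R. J \<subseteq> output_set d \<phi> f P \<omega>} \<in> sets R"
proof -
  have "Measurable.pred R (\<lambda>\<omega>. J \<subseteq> detected d \<omega>)"
    using measurable_compose[OF prefix_measurable[OF d_pos order_refl], of "\<lambda>X. J \<subseteq> X" "count_space UNIV"]
    by simp
  from predE[OF this] show ?thesis
    unfolding output_set_def .
qed

text \<open>The bad events are misses for single coordinates (\<open>X1\<close>), misses for proper
  prefixes (\<open>X2\<close>) and failed constructions (\<open>X3\<close>), each of probability at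
  most \<epsilon> / 3. Outside them \<open>output_complete\<close> applies, with
  \<open>full_coeff_ge\<close> for the last prefix.\<close>

lemma run_success_prob:
  fixes J :: "(nat \<Rightarrow> nat) set" and \<delta> \<epsilon> \<eta> C :: real
  assumes delta: "0 < \<delta>" and eps: "0 < \<epsilon>" "\<epsilon> < 1"
    and J: "J \<subseteq> mindex {1..d}" "J \<noteq> {}" "J \<subseteq> search P"
    and err1: "\<forall>t\<in>{1..d}. \<forall>k\<in>proj {t} J. proj_error_L1 d \<mu> \<phi> c J {t} (rule1 P t) k < ennreal \<eta>"
    and err2: "\<forall>\<omega>\<in>space R. \<forall>t\<in>{2..<d}. constr_ok d \<phi> f P t \<omega> \<longrightarrow>
      (\<forall>k\<in>cand t \<omega> \<inter> proj {1..t} J. proj_error_L1 d \<mu> \<phi> c J {1..t} (used_rule2 d \<phi> f P t \<omega>) k < ennreal \<eta>)"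
    and err3: "\<forall>\<omega>\<in>space R. 2 \<le> d \<longrightarrow> constr_ok d \<phi> f P d \<omega> \<longrightarrow>
      (\<forall>k\<in>cand d \<omega> \<inter> proj {1..d} J. proj_error_L1 d \<mu> \<phi> c J {1..d} (used_rule2 d \<phi> f P d \<omega>) k < ennreal \<eta>)"
    and C: "\<forall>t\<in>{1..d}. cub_const (rule1 P t) \<le> C"
    and threshold: "3 * B * (threshold P + \<eta>) < Min ((\<lambda>k. cmod (c k)) ` J)"
    and iterations: "real (iterations P) \<ge>
      (1 + 3 / 2 * B ^ 2 * real (card J) + B ^ 3 * C / (2 * \<delta>) * (\<Sum>\<^sub>\<infinity>h\<in>mindex {1..d} - J. cmod (c h)))
      * (ln 3 + ln (real d) + ln (real (card J)) - ln \<epsilon>)"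
    and harmless: "cutoff_harmless d \<mu> \<phi> f S P J"
    and failure: "\<forall>t\<in>{2..d}. measure R {\<omega>\<in>space R. \<not> constr_ok d \<phi> f P t \<omega>} \<le> \<epsilon> / (3 * real d)"
  shows "measure R {\<omega>\<in>space R. J \<subseteq> output_set d \<phi> f P \<omega>} \<ge> 1 - \<epsilon>"
proof -
  interpret R: prob_space R
    by (rule prob_space_run)
  have fin: "finite J"
    using J(3) params finite_subset by (auto simp: valid_params_def)
  have \<theta>: "0 \<le> threshold P"
    using params by (simp add: valid_params_def)
  define N where "N = real (card J)"
  have N: "1 \<le> N"
    using fin J(2) by (simp add: N_def Suc_le_eq card_gt_0_iff)
  define q where "q = 1 - 2 / (3 * B\<^sup>2 * N)"
  define \<alpha> where "\<alpha> = \<epsilon> / (3 * real d * N)"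
  \<comment> \<open>This fixes the sign of the summand containing C, which takes the place of X in
    \<open>miss_power_le\<close>.\<close>
  have "0 \<le> C"
  proof -
    have "0 \<le> cub_const (rule1 P 1)"
      by (auto simp: cub_const_def split: prod.split intro!: sum_nonneg)
    also have "\<dots> \<le> C"
      using C d_pos by simp
    finally show ?thesis .
  qed
  then have X: "0 \<le> B ^ 3 * C / (2 * \<delta>) * (\<Sum>\<^sub>\<infinity>h\<in>mindex {1..d} - J. cmod (c h))"
    using B_ge_1 delta by (intro mult_nonneg_nonneg divide_nonneg_nonneg infsum_nonneg) auto
  have q: "0 \<le> q" "q ^ iterations P \<le> \<alpha>"
    using miss_power_le[OF B_ge_1 N _ X eps, of "real d" "iterations P"] iterations d_pos
    by (auto simp: q_def \<alpha>_def N_def)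
  have miss1: "measure R (miss1 t k) \<le> \<alpha>" if t: "t \<in> {1..d}" and k: "k \<in> proj {t} J" for t k
  proof -
    have "measure R (miss1 t k) \<le> q ^ iterations P"
      unfolding q_def N_def
      using t k err1 q(1)[unfolded q_def N_def]
      by (intro measure_miss1_le miss_prob_le[OF _ rule1_space fin J(1) proj_mono[OF J(3)] rule1_exact _ _ \<theta> threshold])
        auto
    with q show ?thesis by simp
  qed
  have miss2: "measure R (miss2 J t k) \<le> \<alpha>" if t: "t \<in> {2..<d}" and k: "k \<in> proj {1..t} J" for t k
  proof -
    have "measure R (miss2 J t k) \<le> q ^ iterations P"
    proof (rule measure_miss2_le[OF t q(1)])
      fix \<omega> assume "\<omega> \<in> miss2 J t k"
      then have \<omega>: "\<omega> \<in> space R" "constr_ok d \<phi> f P t \<omega>" "proj {1..t} J \<subseteq> cand t \<omega>"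
        by (auto simp: miss2_def)
      have Q: "used_rule2 d \<phi> f P t \<omega> \<in> space (cubature_space \<mu> {1..t})"
        using t by (intro used_rule2_space \<omega>) auto
      have "proj_error_L1 d \<mu> \<phi> c J {1..t} (used_rule2 d \<phi> f P t \<omega>) k < ennreal \<eta>"
        using err2 t k \<omega> by blast
      moreover have "{1..t} \<subseteq> {1..d}"
        using t by auto
      ultimately show "measure (PiM ({1..d} - {1..t}) \<mu>) {x\<in>space (PiM ({1..d} - {1..t}) \<mu>).
          cmod (pcoeff {1..t} (used_rule2 d \<phi> f P t \<omega>) x k) < threshold P} \<le> q"
        unfolding q_def N_def
        using miss_prob_le[OF _ Q fin J(1) \<omega>(3) \<omega>(2)[unfolded constr_ok_def] k _ \<theta> threshold] by blast
    qed
    with q show ?thesis by simp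
  qed
  define fail where "fail t = {\<omega>\<in>space R. \<not> constr_ok d \<phi> f P t \<omega>}" for t
  have fail_sets: "fail t \<in> sets R" if "t \<in> {2..d}" for t
    using predE[OF constr_ok_measurable[OF that]] sets.sets_Collect_neg[of R "constr_ok d \<phi> f P t"]
    unfolding fail_def by blast
  define X1 where "X1 = (\<Union>t\<in>{1..d}. \<Union>k\<in>proj {t} J. miss1 t k)"
  define X2 where "X2 = (\<Union>t\<in>{2..<d}. \<Union>k\<in>proj {1..t} J. miss2 J t k)"
  define X3 where "X3 = (\<Union>t\<in>{2..d}. fail t)"
  have fin_proj: "finite (proj u J)" for u
    using fin by (simp add: proj_def)
  have \<alpha>: "0 \<le> \<alpha>"
    using eps N by (simp add: \<alpha>_def)
  \<comment> \<open>Projection does not increase cardinality, so each family has at most d N pairs;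
    it is stated for a general \<open>u\<close> to cover both \<open>{t}\<close> and
    \<open>{1..t}\<close>.\<close>
  have \<alpha>_sum: "(\<Sum>t\<in>T. \<Sum>k\<in>proj (u t) J. \<alpha>) \<le> \<epsilon> / 3" if "finite T" "card T \<le> d" for T :: "nat set" and u
  proof -
    have "(\<Sum>t\<in>T. \<Sum>k\<in>proj (u t) J. \<alpha>) \<le> (\<Sum>t\<in>T. N * \<alpha>)"
      using card_proj_le[OF fin] \<alpha> by (intro sum_mono) (auto simp: N_def intro!: mult_right_mono)
    also have "\<dots> \<le> real d * (N * \<alpha>)"
      using that \<alpha> N by (auto intro!: mult_right_mono)
    also have "\<dots> = \<epsilon> / 3"
      using N d_pos by (simp add: \<alpha>_def)
    finally show ?thesis .
  qed
  have X1: "X1 \<in> sets R" "measure R X1 \<le> \<epsilon> / 3"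
  proof -
    have s: "(\<Union>k\<in>proj {t} J. miss1 t k) \<in> sets R" if "t \<in> {1..d}" for t
      using miss1_sets[OF that] fin_proj by (intro sets.finite_UN) auto
    then show "X1 \<in> sets R"
      unfolding X1_def by (rule sets.finite_UN[OF finite_atLeastAtMost])
    have "measure R X1 \<le> (\<Sum>t\<in>{1..d}. measure R (\<Union>k\<in>proj {t} J. miss1 t k))"
      unfolding X1_def by (rule measure_UNION_le[OF finite_atLeastAtMost s])
    also have "\<dots> \<le> (\<Sum>t\<in>{1..d}. \<Sum>k\<in>proj {t} J. measure R (miss1 t k))"
      by (intro sum_mono measure_UNION_le fin_proj miss1_sets)
    also have "\<dots> \<le> (\<Sum>t\<in>{1..d}. \<Sum>k\<in>proj {t} J. \<alpha>)"
      by (intro sum_mono miss1)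
    also have "\<dots> \<le> \<epsilon> / 3"
      by (rule \<alpha>_sum) auto
    finally show "measure R X1 \<le> \<epsilon> / 3" .
  qed
  have X2: "X2 \<in> sets R" "measure R X2 \<le> \<epsilon> / 3"
  proof -
    have s: "(\<Union>k\<in>proj {1..t} J. miss2 J t k) \<in> sets R" if "t \<in> {2..<d}" for t
      using miss2_sets[OF that] fin_proj by (intro sets.finite_UN) auto
    then show "X2 \<in> sets R"
      unfolding X2_def by (rule sets.finite_UN[OF finite_atLeastLessThan])
    have "measure R X2 \<le> (\<Sum>t\<in>{2..<d}. measure R (\<Union>k\<in>proj {1..t} J. miss2 J t k))"
      unfolding X2_def by (rule measure_UNION_le[OF finite_atLeastLessThan s])
    also have "\<dots> \<le> (\<Sum>t\<in>{2..<d}. \<Sum>k\<in>proj {1..t} J. measure R (miss2 J t k))"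
      by (intro sum_mono measure_UNION_le fin_proj miss2_sets)
    also have "\<dots> \<le> (\<Sum>t\<in>{2..<d}. \<Sum>k\<in>proj {1..t} J. \<alpha>)"
      by (intro sum_mono miss2)
    also have "\<dots> \<le> \<epsilon> / 3"
      by (rule \<alpha>_sum) auto
    finally show "measure R X2 \<le> \<epsilon> / 3" .
  qed
  have X3: "X3 \<in> sets R" "measure R X3 \<le> \<epsilon> / 3"
  proof -
    show "X3 \<in> sets R"
      unfolding X3_def by (intro sets.finite_UN fail_sets) auto
    have "measure R X3 \<le> (\<Sum>t\<in>{2..d}. measure R (fail t))"
      unfolding X3_def by (intro measure_UNION_le fail_sets) auto
    also have "\<dots> \<le> (\<Sum>t\<in>{2..d}. \<epsilon> / (3 * real d))"
      using failure by (intro sum_mono) (simp add: fail_def)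
    also have "\<dots> \<le> real d * (\<epsilon> / (3 * real d))"
      using eps unfolding sum_constant by (intro mult_right_mono) auto
    also have "\<dots> = \<epsilon> / 3"
      using d_pos by simp
    finally show "measure R X3 \<le> \<epsilon> / 3" .
  qed
  have "measure R (X1 \<union> X2 \<union> X3) \<le> \<epsilon>"
    using measure_Un_le[OF X1(1) X2(1)]
      measure_Un_le[OF sets.Un[OF X1(1) X2(1)] X3(1)] X1(2) X2(2) X3(2) by linarith
  then have "1 - \<epsilon> \<le> measure R (space R - (X1 \<union> X2 \<union> X3))"
    using X1(1) X2(1) X3(1) by (subst R.prob_compl) auto
  also have "\<dots> \<le> measure R {\<omega>\<in>space R. J \<subseteq> output_set d \<phi> f P \<omega>}"
  proof (rule R.finite_measure_mono[OF _ output_measurable], rule subsetI, rule CollectI, rule conjI)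
    fix \<omega> assume \<omega>': "\<omega> \<in> space R - (X1 \<union> X2 \<union> X3)"
    then show \<omega>: "\<omega> \<in> space R"
      by blast
    have ok: "constr_ok d \<phi> f P t \<omega>" if "t \<in> {2..d}" for t
      using \<omega>' that unfolding X3_def fail_def by blast
    show "J \<subseteq> output_set d \<phi> f P \<omega>"
    proof (rule output_complete[OF \<omega> J(1,3) harmless])
      show "constr_ok d \<phi> f P t \<omega>" if "t \<in> {2..d}" for t
        using that by (rule ok)
      show "\<omega> \<notin> miss1 t k" if "t \<in> {1..d}" "k \<in> proj {t} J" for t k
        using \<omega>' that unfolding X1_def by blast
      show "\<omega> \<notin> miss2 J t k" if "t \<in> {2..<d}" "k \<in> proj {1..t} J" for t k
        using \<omega>' that unfolding X2_def by blast
      show "threshold P \<le> cmod (pcoeff {1..d} (used_rule2 d \<phi> f P d \<omega>) (snd \<omega> ({1..d}, 0)) k)"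
        if d: "2 \<le> d" and cand: "proj {1..d} J \<subseteq> cand d \<omega>" and k: "k \<in> proj {1..d} J" for k
      proof (rule full_coeff_ge[OF _ _ fin J(1) cand _ k _ \<theta> threshold])
        have d': "d \<in> {2..d}"
          using d by simp
        show "used_rule2 d \<phi> f P d \<omega> \<in> space (cubature_space \<mu> {1..d})"
          by (rule used_rule2_space[OF \<omega> d'])
        have "({1..d}, 0) \<in> draws d P"
          by (rule draws_prefix[OF d']) (simp add: iters2_def)
        from measurable_space[OF anchor_measurable[OF this] \<omega>]
        show "snd \<omega> ({1..d}, 0) \<in> space (PiM ({1..d} - {1..d}) \<mu>)" .
        show "cub_exact \<phi> {1..d} (cand d \<omega>) (used_rule2 d \<phi> f P d \<omega>)"
          using ok[OF d'] by (simp add: constr_ok_def)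
        show "proj_error_L1 d \<mu> \<phi> c J {1..d} (used_rule2 d \<phi> f P d \<omega>) k < ennreal \<eta>"
          using err3 \<omega> d ok[OF d'] cand k by blast
      qed
    qed
  qed
  finally show ?thesis .
qed

end

theorem theorem3p5:
  fixes d :: nat
    and \<mu> :: "nat \<Rightarrow> real measure"
    and \<phi> :: "nat \<Rightarrow> nat \<Rightarrow> real \<Rightarrow> complex"
    and f :: "(nat \<Rightarrow> real) \<Rightarrow> complex"
    and c :: "(nat \<Rightarrow> nat) \<Rightarrow> complex"
    and S :: "'z measure"
    and P :: "'z dia_params"
    and J :: "(nat \<Rightarrow> nat) set"
    and \<delta> \<epsilon> \<delta>\<Psi> C B :: real
  assumes setting: "bounded_product_setting d \<mu> \<phi>"
    and B_eq: "B = bound_const d \<mu> \<phi>"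
    and delta: "0 < \<delta>"
    and eps: "0 < \<epsilon>" "\<epsilon> < 1"
    and smooth: "smooth_enough d \<mu> \<phi> c f"
    and J_eq: "J = large_indices d c (3 * \<delta>)"
    and J_nonempty: "J \<noteq> {}"
    and seed: "prob_space S"
    and params: "valid_params d \<mu> \<phi> S P"
    and delta_Psi: "\<delta>\<Psi> < \<delta>"
    and error_single: "\<forall>t\<in>{1..d}. \<forall>k\<in>proj {t} J.
          proj_error_L1 d \<mu> \<phi> c J {t} (rule1 P t) k < ennreal \<delta>\<Psi>"
    and error_prefix: "\<forall>\<omega>\<in>space (run_space d \<mu> S P). \<forall>t\<in>{2..<d}. constr_ok d \<phi> f P t \<omega> \<longrightarrow>
          (\<forall>k\<in>cand2 d \<phi> f P t \<omega> \<inter> proj {1..t} J.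
             proj_error_L1 d \<mu> \<phi> c J {1..t} (used_rule2 d \<phi> f P t \<omega>) k < ennreal \<delta>\<Psi>)"
    and error_final: "\<forall>\<omega>\<in>space (run_space d \<mu> S P). 2 \<le> d \<longrightarrow> constr_ok d \<phi> f P d \<omega> \<longrightarrow>
          (\<forall>k\<in>cand2 d \<phi> f P d \<omega> \<inter> proj {1..d} J.
             proj_error_L1 d \<mu> \<phi> c J {1..d} (used_rule2 d \<phi> f P d \<omega>) k < ennreal \<delta>\<Psi>)"
    and C_single: "\<forall>t\<in>{1..d}. cub_const (rule1 P t) \<le> C"
    and C_prefix: "\<forall>\<omega>\<in>space (run_space d \<mu> S P). \<forall>t\<in>{2..d}. constr_ok d \<phi> f P t \<omega> \<longrightarrow>
          cub_const (used_rule2 d \<phi> f P t \<omega>) \<le> C"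
    and search_space: "J \<subseteq> search P"
    and threshold: "3 * B * (threshold P + \<delta>\<Psi>) < Min ((\<lambda>k. cmod (c k)) ` J)"
    and iterations: "real (iterations P) \<ge>
          (1 + 3 / 2 * B ^ 2 * real (card J)
             + B ^ 3 * C / (2 * \<delta>) * (\<Sum>\<^sub>\<infinity>h\<in>mindex {1..d} - J. cmod (c h)))
          * (ln 3 + ln (real d) + ln (real (card J)) - ln \<epsilon>)"
    and sparsity: "cutoff_harmless d \<mu> \<phi> f S P J"
    and failure: "\<forall>t\<in>{2..d}. measure (run_space d \<mu> S P)
          {\<omega> \<in> space (run_space d \<mu> S P). \<not> constr_ok d \<phi> f P t \<omega>} \<le> \<epsilon> / (3 * real d)"
  shows "measure (run_space d \<mu> S P)
          {\<omega> \<in> space (run_space d \<mu> S P). J \<subseteq> output_set d \<phi> f P \<omega>} \<ge> 1 - \<epsilon>"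
proof -
  interpret dia_run d \<mu> \<phi> c f S P
    by (intro dia_run.intro product_expansion.intro product_basis.intro product_expansion_axioms.intro
      dia_run_axioms.intro setting smooth seed params)
  have B: "B = product_basis.B d \<mu> \<phi>"
    by (simp add: B_eq product_basis.B_def[OF product_basis_axioms])
  have "J \<subseteq> mindex {1..d}"
    by (auto simp: J_eq large_indices_def)
  from run_success_prob[OF delta eps this J_nonempty search_space error_single error_prefix error_final
      C_single threshold[unfolded B] iterations[unfolded B] sparsity failure]
  show ?thesis .
qed

end
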